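(* Let $G$ be a finite group acting faithfully on a finite set $M$. Let $H$ and $H'$ be two orbit-maximal subgroups of $G$ and let $X$ and $X'$ be simple complex modules over $\mathrm{N}_G(H)/H$ and $\mathrm{N}_G(H')/H'$, respectively. Then the $\mathcal{FP}^+(G,M)$-module $L(H,X)\otimes_{\mathbb{C}}L(H',X')$ is completely reducible.
   Context: The factorpower $\mathcal{FP}^+(G,M)$ of a finite group $G$ acting (on the left) on a finite set $M$ is the finite monoid whose elements are the classes $\overline{A}$ of nonempty subsets $A\subset G$ under the congruence $A\sim_M B$ iff $\{a(m)\mid a\in A\}=\{b(m)\mid b\in B\}$ for all $m\in M$, with multiplication $\overline{A}\,\overline{B}=\overline{AB}$, where $AB=\{ab\mid a\in A,b\in B\}$. Two subgroups of $G$ are orbit-equivalent if they have the same orbits on $M$; a subgroup is orbit-maximal if it is the (unique) maximal element, with respect to inclusion, among all subgroups orbit-equivalent to it. For $H$ orbit-maximal, $\overline{H}$ is an idempotent and $X\mapsto\overline{X}$ identifies $\mathrm{N}_G(H)/H$ with the maximal subgroup ($\mathcal{H}$-class) of $\mathcal{FP}^+(G,M)$ with identity $\overline{H}$, where $\mathrm{N}_G(H)$ is the normalizer of $H$ in $G$. Let $\mathcal{L}_H$ be the $\mathcal{L}$-class of $\overline{H}$ in $\mathcal{FP}^+(G,M)$, and let $V_H$ be the formal $\mathbb{C}$-span of $\mathcal{L}_H$ with the $\mathcal{FP}^+(G,M)$-$\mathrm{N}_G(H)/H$-bimodule structure given for $x\in\mathcal{L}_H$, $s\in\mathcal{FP}^+(G,M)$,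 $g\in\mathrm{N}_G(H)/H$ by $s\cdot x\cdot g=sxg$ if $sxg\in\mathcal{L}_H$, and $0$ otherwise. For a simple complex $\mathrm{N}_G(H)/H$-module $X$ put $L(H,X)=V_H\otimes_{\mathrm{N}_G(H)/H}X$; this is the simple $\mathcal{FP}^+(G,M)$-module associated with $H$ and $X$ (every simple complex $\mathcal{FP}^+(G,M)$-module is of this form). A semigroup $S$ acts on the tensor product of two $S$-modules diagonally: $s(x\otimes y)=s(x)\otimes s(y)$. *)

theory Defs
  imports
    Complex_Main
    "HOL-Library.Poly_Mapping"
    "HOL-Algebra.Group_Action"
    "HOL-Algebra.Module"
    "HOL-Algebra.AbelCoset"
    "HOL-Algebra.Algebraic_Closure_Type"
begin

abbreviation complex_ring :: "complex ring"
  where "complex_ring \<equiv> ring_of_type_algebra"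

locale monoid_module = S: monoid S + V: module complex_ring V
  for S :: "('s, 'e) monoid_scheme" and V :: "(complex, 'v, 'f) module_scheme"
    and act :: "'s \<Rightarrow> 'v \<Rightarrow> 'v" +
  assumes act_closed: "\<lbrakk>s \<in> carrier S; v \<in> carrier V\<rbrakk> \<Longrightarrow> act s v \<in> carrier V"
    and act_add: "\<lbrakk>s \<in> carrier S; v \<in> carrier V; w \<in> carrier V\<rbrakk>
      \<Longrightarrow> act s (v \<oplus>\<^bsub>V\<^esub> w) = act s v \<oplus>\<^bsub>V\<^esub> act s w"
    and act_smult: "\<lbrakk>s \<in> carrier S; v \<in> carrier V\<rbrakk>
      \<Longrightarrow> act s (c \<odot>\<^bsub>V\<^esub> v) = c \<odot>\<^bsub>V\<^esub> act s v"
    and act_mult: "\<lbrakk>s \<in> carrier S; t \<in> carrier S; v \<in> carrier V\<rbrakk>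
      \<Longrightarrow> act (s \<otimes>\<^bsub>S\<^esub> t) v = act s (act t v)"
    and act_one: "v \<in> carrier V \<Longrightarrow> act \<one>\<^bsub>S\<^esub> v = v"

definition invariant_submodule ::
  "('s, 'e) monoid_scheme \<Rightarrow> (complex, 'v, 'f) module_scheme \<Rightarrow> ('s \<Rightarrow> 'v \<Rightarrow> 'v) \<Rightarrow> 'v set \<Rightarrow> bool"
  where "invariant_submodule S V act W \<longleftrightarrow>
    submodule W complex_ring V \<and> (\<forall>s\<in>carrier S. \<forall>w\<in>W. act s w \<in> W)"

definition simple_module ::
  "('s, 'e) monoid_scheme \<Rightarrow> (complex, 'v, 'f) module_scheme \<Rightarrow> ('s \<Rightarrow> 'v \<Rightarrow> 'v) \<Rightarrow> bool"
  where "simple_module S V act \<longleftrightarrow>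
    monoid_module S V act \<and> carrier V \<noteq> {\<zero>\<^bsub>V\<^esub>} \<and>
    (\<forall>W. invariant_submodule S V act W \<longrightarrow> W = {\<zero>\<^bsub>V\<^esub>} \<or> W = carrier V)"

text \<open>Completely reducible means: internal direct sum of a (possibly infinite) family of simple
  submodules, i.e. every vector has a unique expansion with finitely many nonzero components.\<close>

definition completely_reducible ::
  "('s, 'e) monoid_scheme \<Rightarrow> (complex, 'v, 'f) module_scheme \<Rightarrow> ('s \<Rightarrow> 'v \<Rightarrow> 'v) \<Rightarrow> bool"
  where "completely_reducible S V act \<longleftrightarrow>
    monoid_module S V act \<and>
    (\<exists>\<W>. (\<forall>W\<in>\<W>. invariant_submodule S V act W \<and> simple_module S (V\<lparr>carrier := W\<rparr>) act) \<and>
      (\<forall>v\<in>carrier V. \<exists>!f. f \<in> (\<Pi>\<^sub>E W\<in>\<W>. W) \<and> finite {W\<in>\<W>. f W \<noteq> \<zero>\<^bsub>V\<^esub>} \<and>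
        v = (\<Oplus>\<^bsub>V\<^esub>W\<in>{W\<in>\<W>. f W \<noteq> \<zero>\<^bsub>V\<^esub>}. f W)))"

text \<open>The multiplicative fields of a module record are irrelevant and left unspecified.\<close>

definition free_module :: "'b set \<Rightarrow> (complex, 'b \<Rightarrow>\<^sub>0 complex) module"
  where "free_module B =
    \<lparr>carrier = {f. Poly_Mapping.keys f \<subseteq> B}, monoid.mult = undefined, one = undefined,
     zero = 0, add = (+), module.smult = (\<lambda>c. Poly_Mapping.map ((*) c))\<rparr>"

definition linear_extension :: "('b \<Rightarrow> 'c \<Rightarrow>\<^sub>0 complex) \<Rightarrow> ('b \<Rightarrow>\<^sub>0 complex) \<Rightarrow> 'c \<Rightarrow>\<^sub>0 complex"
  where "linear_extension h f =
    (\<Sum>b\<in>Poly_Mapping.keys f. Poly_Mapping.map ((*) (Poly_Mapping.lookup f b)) (h b))"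

definition generated_submodule :: "(complex, 'v, 'f) module_scheme \<Rightarrow> 'v set \<Rightarrow> 'v set"
  where "generated_submodule V E = \<Inter>{N. submodule N complex_ring V \<and> E \<subseteq> N}"

definition quotient_module :: "(complex, 'v, 'f) module_scheme \<Rightarrow> 'v set \<Rightarrow> (complex, 'v set) module"
  where "quotient_module V N =
    \<lparr>carrier = a_rcosets\<^bsub>V\<^esub> N, monoid.mult = undefined, one = undefined,
     zero = N, add = (\<lambda>C D. C <+>\<^bsub>V\<^esub> D),
     module.smult = (\<lambda>c C. \<Union>v\<in>C. N +>\<^bsub>V\<^esub> (c \<odot>\<^bsub>V\<^esub> v))\<rparr>"

definition bilinear_relations ::
  "(complex, 'v, 'f) module_scheme \<Rightarrow> (complex, 'w, 'g) module_scheme \<Rightarrow> ('v \<times> 'w \<Rightarrow>\<^sub>0 complex) set"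
  where "bilinear_relations V W =
    {Poly_Mapping.single (v \<oplus>\<^bsub>V\<^esub> v', w) 1 - Poly_Mapping.single (v, w) 1 - Poly_Mapping.single (v', w) 1
      | v v' w. v \<in> carrier V \<and> v' \<in> carrier V \<and> w \<in> carrier W} \<union>
    {Poly_Mapping.single (v, w \<oplus>\<^bsub>W\<^esub> w') 1 - Poly_Mapping.single (v, w) 1 - Poly_Mapping.single (v, w') 1
      | v w w'. v \<in> carrier V \<and> w \<in> carrier W \<and> w' \<in> carrier W} \<union>
    {Poly_Mapping.single (c \<odot>\<^bsub>V\<^esub> v, w) 1 - Poly_Mapping.single (v, w) c
      | c v w. v \<in> carrier V \<and> w \<in> carrier W} \<union>
    {Poly_Mapping.single (v, c \<odot>\<^bsub>W\<^esub> w) 1 - Poly_Mapping.single (v, w) c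
      | c v w. v \<in> carrier V \<and> w \<in> carrier W}"

definition balanced_relations ::
  "'k set \<Rightarrow> (complex, 'v, 'f) module_scheme \<Rightarrow> ('v \<Rightarrow> 'k \<Rightarrow> 'v) \<Rightarrow>
   (complex, 'w, 'g) module_scheme \<Rightarrow> ('k \<Rightarrow> 'w \<Rightarrow> 'w) \<Rightarrow> ('v \<times> 'w \<Rightarrow>\<^sub>0 complex) set"
  where "balanced_relations K V ract W lact =
    {Poly_Mapping.single (ract v k, w) 1 - Poly_Mapping.single (v, lact k w) 1
      | v k w. v \<in> carrier V \<and> k \<in> K \<and> w \<in> carrier W}"

text \<open>Tensor product over the complex numbers with extra relations \<open>E\<close> imposed: \<open>E = {}\<close> gives the
  tensor product over the complex numbers, and the balanced relations of a group give the tensor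
  product over that group (equivalently, over its complex group algebra).\<close>

definition tensor_kernel ::
  "(complex, 'v, 'f) module_scheme \<Rightarrow> (complex, 'w, 'g) module_scheme \<Rightarrow>
   ('v \<times> 'w \<Rightarrow>\<^sub>0 complex) set \<Rightarrow> ('v \<times> 'w \<Rightarrow>\<^sub>0 complex) set"
  where "tensor_kernel V W E =
    generated_submodule (free_module (carrier V \<times> carrier W)) (bilinear_relations V W \<union> E)"

definition tensor_module ::
  "(complex, 'v, 'f) module_scheme \<Rightarrow> (complex, 'w, 'g) module_scheme \<Rightarrow>
   ('v \<times> 'w \<Rightarrow>\<^sub>0 complex) set \<Rightarrow> (complex, ('v \<times> 'w \<Rightarrow>\<^sub>0 complex) set) module"
  where "tensor_module V W E =
    quotient_module (free_module (carrier V \<times> carrier W)) (tensor_kernel V W E)"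

text \<open>The endomorphism of the tensor product sending the class of \<open>v \<otimes> w\<close> to that of \<open>f v \<otimes> g w\<close>.\<close>

definition tensor_map ::
  "(complex, 'v, 'f) module_scheme \<Rightarrow> (complex, 'w, 'g) module_scheme \<Rightarrow>
   ('v \<times> 'w \<Rightarrow>\<^sub>0 complex) set \<Rightarrow> ('v \<Rightarrow> 'v) \<Rightarrow> ('w \<Rightarrow> 'w) \<Rightarrow>
   ('v \<times> 'w \<Rightarrow>\<^sub>0 complex) set \<Rightarrow> ('v \<times> 'w \<Rightarrow>\<^sub>0 complex) set"
  where "tensor_map V W E f g C =
    (\<Union>u\<in>C. tensor_kernel V W E +>\<^bsub>free_module (carrier V \<times> carrier W)\<^esub>
      linear_extension (\<lambda>(v, w). Poly_Mapping.single (f v, g w) 1) u)"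

definition fp_eqv :: "('g, 'e) monoid_scheme \<Rightarrow> 'm set \<Rightarrow> ('g \<Rightarrow> 'm \<Rightarrow> 'm) \<Rightarrow> ('g set \<times> 'g set) set"
  where "fp_eqv G M \<phi> =
    {(A, B). A \<subseteq> carrier G \<and> A \<noteq> {} \<and> B \<subseteq> carrier G \<and> B \<noteq> {} \<and>
       (\<forall>m\<in>M. {\<phi> a m | a. a \<in> A} = {\<phi> b m | b. b \<in> B})}"

definition fp_class :: "('g, 'e) monoid_scheme \<Rightarrow> 'm set \<Rightarrow> ('g \<Rightarrow> 'm \<Rightarrow> 'm) \<Rightarrow> 'g set \<Rightarrow> 'g set set"
  where "fp_class G M \<phi> A = fp_eqv G M \<phi> `` {A}"

definition factorpower :: "('g, 'e) monoid_scheme \<Rightarrow> 'm set \<Rightarrow> ('g \<Rightarrow> 'm \<Rightarrow> 'm) \<Rightarrow> 'g set set monoid"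
  where "factorpower G M \<phi> =
    \<lparr>carrier = {A. A \<subseteq> carrier G \<and> A \<noteq> {}} // fp_eqv G M \<phi>,
     monoid.mult = (\<lambda>C D. \<Union>A\<in>C. \<Union>B\<in>D. fp_class G M \<phi> (A <#>\<^bsub>G\<^esub> B)),
     one = fp_class G M \<phi> {\<one>\<^bsub>G\<^esub>}\<rparr>"

definition orbit_equivalent ::
  "('g, 'e) monoid_scheme \<Rightarrow> 'm set \<Rightarrow> ('g \<Rightarrow> 'm \<Rightarrow> 'm) \<Rightarrow> 'g set \<Rightarrow> 'g set \<Rightarrow> bool"
  where "orbit_equivalent G M \<phi> H K \<longleftrightarrow>
    orbits (G\<lparr>carrier := H\<rparr>) M \<phi> = orbits (G\<lparr>carrier := K\<rparr>) M \<phi>"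

text \<open>A maximal element of an orbit-equivalence class is automatically the greatest one: orbit-equivalent
  subgroups generate a subgroup with the same orbits.\<close>

definition orbit_maximal ::
  "('g, 'e) monoid_scheme \<Rightarrow> 'm set \<Rightarrow> ('g \<Rightarrow> 'm \<Rightarrow> 'm) \<Rightarrow> 'g set \<Rightarrow> bool"
  where "orbit_maximal G M \<phi> H \<longleftrightarrow>
    subgroup H G \<and>
    (\<forall>K. subgroup K G \<and> orbit_equivalent G M \<phi> H K \<and> H \<subseteq> K \<longrightarrow> K = H)"

abbreviation normalizer_quotient :: "('g, 'e) monoid_scheme \<Rightarrow> 'g set \<Rightarrow> 'g set monoid"
  where "normalizer_quotient G H \<equiv> G\<lparr>carrier := normalizer G H\<rparr> Mod H"

definition green_L :: "('s, 'e) monoid_scheme \<Rightarrow> ('s \<times> 's) set"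
  where "green_L S =
    {(x, y). x \<in> carrier S \<and> y \<in> carrier S \<and>
       {s \<otimes>\<^bsub>S\<^esub> x | s. s \<in> carrier S} = {s \<otimes>\<^bsub>S\<^esub> y | s. s \<in> carrier S}}"

definition L_class ::
  "('g, 'e) monoid_scheme \<Rightarrow> 'm set \<Rightarrow> ('g \<Rightarrow> 'm \<Rightarrow> 'm) \<Rightarrow> 'g set \<Rightarrow> 'g set set set"
  where "L_class G M \<phi> H = green_L (factorpower G M \<phi>) `` {fp_class G M \<phi> H}"

definition V_module ::
  "('g, 'e) monoid_scheme \<Rightarrow> 'm set \<Rightarrow> ('g \<Rightarrow> 'm \<Rightarrow> 'm) \<Rightarrow> 'g set \<Rightarrow>
   (complex, 'g set set \<Rightarrow>\<^sub>0 complex) module"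
  where "V_module G M \<phi> H = free_module (L_class G M \<phi> H)"

text \<open>An element \<open>g\<close> of the normalizer quotient is a coset, hence a subset of \<open>G\<close>, and acts through
  its class in the factorpower.\<close>

definition V_biact ::
  "('g, 'e) monoid_scheme \<Rightarrow> 'm set \<Rightarrow> ('g \<Rightarrow> 'm \<Rightarrow> 'm) \<Rightarrow> 'g set \<Rightarrow>
   'g set set \<Rightarrow> ('g set set \<Rightarrow>\<^sub>0 complex) \<Rightarrow> 'g set \<Rightarrow> ('g set set \<Rightarrow>\<^sub>0 complex)"
  where "V_biact G M \<phi> H s v g = linear_extension
    (\<lambda>x. let y = s \<otimes>\<^bsub>factorpower G M \<phi>\<^esub> x \<otimes>\<^bsub>factorpower G M \<phi>\<^esub> fp_class G M \<phi> g
         in if y \<in> L_class G M \<phi> H then Poly_Mapping.single y 1 else 0) v"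

definition V_left ::
  "('g, 'e) monoid_scheme \<Rightarrow> 'm set \<Rightarrow> ('g \<Rightarrow> 'm \<Rightarrow> 'm) \<Rightarrow> 'g set \<Rightarrow>
   'g set set \<Rightarrow> ('g set set \<Rightarrow>\<^sub>0 complex) \<Rightarrow> ('g set set \<Rightarrow>\<^sub>0 complex)"
  where "V_left G M \<phi> H s v = V_biact G M \<phi> H s v \<one>\<^bsub>normalizer_quotient G H\<^esub>"

definition V_right ::
  "('g, 'e) monoid_scheme \<Rightarrow> 'm set \<Rightarrow> ('g \<Rightarrow> 'm \<Rightarrow> 'm) \<Rightarrow> 'g set \<Rightarrow>
   ('g set set \<Rightarrow>\<^sub>0 complex) \<Rightarrow> 'g set \<Rightarrow> ('g set set \<Rightarrow>\<^sub>0 complex)"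
  where "V_right G M \<phi> H v g = V_biact G M \<phi> H \<one>\<^bsub>factorpower G M \<phi>\<^esub> v g"

definition L_relations ::
  "('g, 'e) monoid_scheme \<Rightarrow> 'm set \<Rightarrow> ('g \<Rightarrow> 'm \<Rightarrow> 'm) \<Rightarrow> 'g set \<Rightarrow>
   (complex, 'x, 'f) module_scheme \<Rightarrow> ('g set \<Rightarrow> 'x \<Rightarrow> 'x) \<Rightarrow>
   (('g set set \<Rightarrow>\<^sub>0 complex) \<times> 'x \<Rightarrow>\<^sub>0 complex) set"
  where "L_relations G M \<phi> H U \<rho> =
    balanced_relations (carrier (normalizer_quotient G H)) (V_module G M \<phi> H) (V_right G M \<phi> H) U \<rho>"

definition L_module ::
  "('g, 'e) monoid_scheme \<Rightarrow> 'm set \<Rightarrow> ('g \<Rightarrow> 'm \<Rightarrow> 'm) \<Rightarrow> 'g set \<Rightarrow>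
   (complex, 'x, 'f) module_scheme \<Rightarrow> ('g set \<Rightarrow> 'x \<Rightarrow> 'x) \<Rightarrow>
   (complex, (('g set set \<Rightarrow>\<^sub>0 complex) \<times> 'x \<Rightarrow>\<^sub>0 complex) set) module"
  where "L_module G M \<phi> H U \<rho> = tensor_module (V_module G M \<phi> H) U (L_relations G M \<phi> H U \<rho>)"

definition L_act ::
  "('g, 'e) monoid_scheme \<Rightarrow> 'm set \<Rightarrow> ('g \<Rightarrow> 'm \<Rightarrow> 'm) \<Rightarrow> 'g set \<Rightarrow>
   (complex, 'x, 'f) module_scheme \<Rightarrow> ('g set \<Rightarrow> 'x \<Rightarrow> 'x) \<Rightarrow> 'g set set \<Rightarrow>
   (('g set set \<Rightarrow>\<^sub>0 complex) \<times> 'x \<Rightarrow>\<^sub>0 complex) set \<Rightarrow>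
   (('g set set \<Rightarrow>\<^sub>0 complex) \<times> 'x \<Rightarrow>\<^sub>0 complex) set"
  where "L_act G M \<phi> H U \<rho> s =
    tensor_map (V_module G M \<phi> H) U (L_relations G M \<phi> H U \<rho>) (V_left G M \<phi> H s) id"

end

theory Submission
  imports Defs
begin

text \<open>For \<open>H\<close> orbit-maximal, the \<open>\<L>\<close>-class of \<open>H\<close> consists of the classes of the left cosets
  \<open>g H\<close>, and the class of \<open>A\<close> sends \<open>g H\<close> to \<open>g' H\<close> iff \<open>g'\<inverse> A g \<subseteq> H\<close>. Hence
  \<open>A\<close> and \<open>A\<inverse>\<close> act on the \<open>\<L>\<close>-class by mutually inverse partial injections, for every
  \<open>H\<close> at the same time. On the free module over the product of two \<open>\<L>\<close>-classes, with the inner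
  product that makes the basis orthonormal, the operators of \<open>A\<close> and \<open>A\<inverse>\<close> are therefore adjoint,
  so that every invariant subspace has an invariant orthogonal complement and this module is semisimple.
  The tensor product of the two \<open>L\<close>-modules is spanned by the images of this free module under the
  homomorphisms \<open>(x, x') \<mapsto> (x \<otimes> u) \<otimes> (x' \<otimes> u')\<close>, so it is a sum of simple submodules.\<close>

text \<open>The tensor product is a quotient built from quotients: it carries no distinguished basis
  and no inner product, and X and X' come without a basis as well. Orthogonality is therefore used
  only on the finite set of pairs, one copy for each choice of vectors u and u'; in the tensor
  product itself only homomorphic images occur. Sums of simple submodules are turned into direct
  sums once, for arbitrary modules, by Zorn's lemma. The adjoint is special to these modules: in the
  monoid itself, the class of A\<inverse> is in general not even a generalised inverse of that of A.
  For A = {1, c} with c a 3-cycle on three points, A A\<inverse> A sends each point to all three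
  points, but A sends it to two only. The rescue is orbit-maximality: equality of classes compares
  images point by point, and maximality converts this into membership of single group elements in H,
  a condition that inversion reverses.\<close>

no_notation subset_mset (infix \<open><#\<close> 50)

section \<open>Sums of simple modules\<close>

lemma complex_ring_simps [simp]:
  "carrier complex_ring = UNIV" "\<one>\<^bsub>complex_ring\<^esub> = 1" "\<zero>\<^bsub>complex_ring\<^esub> = 0"
  "a \<oplus>\<^bsub>complex_ring\<^esub> b = a + b" "a \<otimes>\<^bsub>complex_ring\<^esub> b = a * b"
  by (simp_all add: ring_of_type_algebra_def)

lemma complex_ring_minus [simp]: "\<ominus>\<^bsub>complex_ring\<^esub> a = - a"
proof -
  interpret cring complex_ring by (rule cring_from_type_algebra)
  show ?thesis using minus_equality[of "- a" a] by simp
qed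

text \<open>Negation is scaling by -1, so closure under it need not be listed. Submodule proofs
  below are reduced to this list.\<close>

lemma submodule_iff:
  assumes "module complex_ring V"
  shows "submodule N complex_ring V \<longleftrightarrow>
    N \<subseteq> carrier V \<and> \<zero>\<^bsub>V\<^esub> \<in> N \<and> (\<forall>v\<in>N. \<forall>w\<in>N. v \<oplus>\<^bsub>V\<^esub> w \<in> N) \<and> (\<forall>c. \<forall>v\<in>N. c \<odot>\<^bsub>V\<^esub> v \<in> N)"
    (is "_ \<longleftrightarrow> ?closed")
proof
  interpret module complex_ring V by fact
  show ?closed if N: "submodule N complex_ring V"
    using submoduleE[OF N] subgroup.one_closed[OF submodule.axioms(1)[OF N]] by auto
  show "submodule N complex_ring V" if N: ?closed
  proof (rule submoduleI)
    fix v assume "v \<in> N"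
    then show "\<ominus>\<^bsub>V\<^esub> v \<in> N"
      using N smult_l_minus[of 1 v] smult_one[of v] by (simp add: subset_iff) metis
  qed (use N in auto)
qed

lemma submodule_submodule_iff:
  assumes "module complex_ring V" "submodule W complex_ring V"
  shows "submodule N complex_ring (V\<lparr>carrier := W\<rparr>) \<longleftrightarrow> submodule N complex_ring V \<and> N \<subseteq> W"
  using assms submodule.submodule_is_module[OF assms(2,1)]
  by (auto simp: submodule_iff)

lemma monoid_module_submodule:
  assumes "monoid_module S V act" "invariant_submodule S V act W"
  shows "monoid_module S (V\<lparr>carrier := W\<rparr>) act"
proof -
  interpret monoid_module S V act by fact
  have W: "submodule W complex_ring V" "\<And>s w. s \<in> carrier S \<Longrightarrow> w \<in> W \<Longrightarrow> act s w \<in> W"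
    using assms(2) by (auto simp: invariant_submodule_def)
  then have "W \<subseteq> carrier V" by (simp add: V.submoduleE)
  with W show ?thesis
    by (intro monoid_module.intro monoid_module_axioms.intro S.monoid_axioms
        submodule.submodule_is_module[OF W(1) V.module_axioms])
      (auto simp: act_add act_smult act_mult act_one subset_iff)
qed

lemma invariant_submodule_submodule_iff:
  assumes "module complex_ring V" "invariant_submodule S V act W"
  shows "invariant_submodule S (V\<lparr>carrier := W\<rparr>) act N \<longleftrightarrow> invariant_submodule S V act N \<and> N \<subseteq> W"
  using assms by (auto simp: invariant_submodule_def submodule_submodule_iff)

definition simple_submodule ::
  "('s, 'e) monoid_scheme \<Rightarrow> (complex, 'v, 'f) module_scheme \<Rightarrow> ('s \<Rightarrow> 'v \<Rightarrow> 'v) \<Rightarrow> 'v set \<Rightarrow> bool"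
  where "simple_submodule S V act W \<longleftrightarrow>
    invariant_submodule S V act W \<and> simple_module S (V\<lparr>carrier := W\<rparr>) act"

text \<open>Simplicity is defined through the restricted record
  \<open>V\<lparr>carrier := W\<rparr>\<close>. Its operations are those of \<open>V\<close>, so its
  submodules are the submodules of \<open>V\<close> inside \<open>W\<close>, and later arguments can
  stay in \<open>V\<close>.\<close>

lemma simple_submodule_iff:
  assumes "monoid_module S V act"
  shows "simple_submodule S V act W \<longleftrightarrow> invariant_submodule S V act W \<and> W \<noteq> {\<zero>\<^bsub>V\<^esub>} \<and>
    (\<forall>N. invariant_submodule S V act N \<and> N \<subseteq> W \<longrightarrow> N = {\<zero>\<^bsub>V\<^esub>} \<or> N = W)"
proof -
  have "module complex_ring V"
    using assms by (simp add: monoid_module_def)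
  then show ?thesis
    using monoid_module_submodule[OF assms]
    by (auto simp: simple_submodule_def simple_module_def invariant_submodule_submodule_iff)
qed

section \<open>Independent families of submodules and Zorn's lemma\<close>

context monoid_module
begin

lemma invariant_submodule_iff:
  "invariant_submodule S V act N \<longleftrightarrow>
    N \<subseteq> carrier V \<and> \<zero>\<^bsub>V\<^esub> \<in> N \<and> (\<forall>v\<in>N. \<forall>w\<in>N. v \<oplus>\<^bsub>V\<^esub> w \<in> N) \<and> (\<forall>c. \<forall>v\<in>N. c \<odot>\<^bsub>V\<^esub> v \<in> N) \<and>
    (\<forall>s\<in>carrier S. \<forall>v\<in>N. act s v \<in> N)"
  by (auto simp: invariant_submodule_def submodule_iff[OF V.module_axioms])

lemma one_smult [simp]: "v \<in> carrier V \<Longrightarrow> 1 \<odot>\<^bsub>V\<^esub> v = v"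
  using V.smult_one by simp

lemma minus_one_smult: "v \<in> carrier V \<Longrightarrow> (- 1) \<odot>\<^bsub>V\<^esub> v = \<ominus>\<^bsub>V\<^esub> v"
  using V.smult_l_minus[of 1 v] by simp

lemma act_zero: "s \<in> carrier S \<Longrightarrow> act s \<zero>\<^bsub>V\<^esub> = \<zero>\<^bsub>V\<^esub>"
  using act_smult[of s "\<zero>\<^bsub>V\<^esub>" 0] V.smult_l_null[of "\<zero>\<^bsub>V\<^esub>"] V.smult_l_null[of "act s \<zero>\<^bsub>V\<^esub>"]
  by (simp add: act_closed)

lemma act_finsum:
  assumes "s \<in> carrier S" "finite A" "f \<in> A \<rightarrow> carrier V"
  shows "act s (\<Oplus>\<^bsub>V\<^esub>i\<in>A. f i) = (\<Oplus>\<^bsub>V\<^esub>i\<in>A. act s (f i))"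
  using assms(2,3,1)
  by (induction A rule: finite_induct) (auto simp: act_zero act_add act_closed Pi_iff)

text \<open>The uniqueness half of a direct sum, stated at the vector zero. \<open>F\<close> is
  finite because the family itself may be infinite.\<close>

definition independent :: "'v set set \<Rightarrow> bool"
  where "independent \<W> \<longleftrightarrow> (\<forall>F f. finite F \<and> F \<subseteq> \<W> \<and> (\<forall>W\<in>F. f W \<in> W) \<and>
    (\<Oplus>\<^bsub>V\<^esub>W\<in>F. f W) = \<zero>\<^bsub>V\<^esub> \<longrightarrow> (\<forall>W\<in>F. f W = \<zero>\<^bsub>V\<^esub>))"

lemma independentD:
  assumes "independent \<W>" "finite F" "F \<subseteq> \<W>" "\<forall>W\<in>F. f W \<in> W" "(\<Oplus>\<^bsub>V\<^esub>W\<in>F. f W) = \<zero>\<^bsub>V\<^esub>"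
  shows "\<forall>W\<in>F. f W = \<zero>\<^bsub>V\<^esub>"
  using assms unfolding independent_def by blast

definition sum_of_family :: "'v set set \<Rightarrow> 'v set"
  where "sum_of_family \<W> = {\<Oplus>\<^bsub>V\<^esub>W\<in>F. f W | F f. finite F \<and> F \<subseteq> \<W> \<and> (\<forall>W\<in>F. f W \<in> W)}"

text \<open>Padding with zeros brings two finite sums to a common index set, where they can be added
  term by term.\<close>

lemma sum_of_family_extend:
  assumes "finite F'" "F \<subseteq> F'" "F' \<subseteq> \<W>" "\<And>W. W \<in> \<W> \<Longrightarrow> invariant_submodule S V act W" "\<forall>W\<in>F. f W \<in> W"
  shows "(\<Oplus>\<^bsub>V\<^esub>W\<in>F. f W) = (\<Oplus>\<^bsub>V\<^esub>W\<in>F'. if W \<in> F then f W else \<zero>\<^bsub>V\<^esub>)"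
proof -
  have "f W \<in> carrier V" if "W \<in> F" for W
    using assms that by (meson invariant_submodule_iff subset_iff)
  then show ?thesis
    using assms(1,2) by (intro V.add.finprod_mono_neutral_cong_left) auto
qed

lemma sum_of_family_invariant:
  assumes "\<And>W. W \<in> \<W> \<Longrightarrow> invariant_submodule S V act W"
  shows "invariant_submodule S V act (sum_of_family \<W>)"
proof -
  note inv = assms[unfolded invariant_submodule_iff]
  have carr: "f W \<in> carrier V" if "W \<in> F" "F \<subseteq> \<W>" "\<forall>W\<in>F. f W \<in> W" for W F and f :: "_ \<Rightarrow> 'v"
    using inv[of W] that by blast
  have I: "(\<Oplus>\<^bsub>V\<^esub>W\<in>F. f W) \<in> sum_of_family \<W>"
    if "finite F" "F \<subseteq> \<W>" "\<forall>W\<in>F. f W \<in> W" for F f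
    using that by (auto simp: sum_of_family_def)
  show ?thesis
    unfolding invariant_submodule_iff
  proof (intro conjI ballI allI)
    show "sum_of_family \<W> \<subseteq> carrier V"
      using carr by (fastforce simp: sum_of_family_def intro!: V.finsum_closed)
    show "\<zero>\<^bsub>V\<^esub> \<in> sum_of_family \<W>" using I[of "{}"] by simp
  next
    fix v w assume "v \<in> sum_of_family \<W>" "w \<in> sum_of_family \<W>"
    then obtain F f F' f' where F: "v = (\<Oplus>\<^bsub>V\<^esub>W\<in>F. f W)" "finite F" "F \<subseteq> \<W>" "\<forall>W\<in>F. f W \<in> W"
      and F': "w = (\<Oplus>\<^bsub>V\<^esub>W\<in>F'. f' W)" "finite F'" "F' \<subseteq> \<W>" "\<forall>W\<in>F'. f' W \<in> W"
      by (auto simp: sum_of_family_def)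
    let ?g = "\<lambda>W. if W \<in> F then f W else \<zero>\<^bsub>V\<^esub>" and ?g' = "\<lambda>W. if W \<in> F' then f' W else \<zero>\<^bsub>V\<^esub>"
    have "v \<oplus>\<^bsub>V\<^esub> w = (\<Oplus>\<^bsub>V\<^esub>W\<in>F \<union> F'. ?g W) \<oplus>\<^bsub>V\<^esub> (\<Oplus>\<^bsub>V\<^esub>W\<in>F \<union> F'. ?g' W)"
      using F F' assms sum_of_family_extend[of "F \<union> F'" F \<W> f]
        sum_of_family_extend[of "F \<union> F'" F' \<W> f'] by simp
    also have "\<dots> = (\<Oplus>\<^bsub>V\<^esub>W\<in>F \<union> F'. ?g W \<oplus>\<^bsub>V\<^esub> ?g' W)"
      using F F' carr[of _ F f] carr[of _ F' f'] by (intro V.finsum_addf[symmetric]) auto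
    also have "\<dots> \<in> sum_of_family \<W>"
    proof (rule I)
      show "\<forall>W\<in>F \<union> F'. ?g W \<oplus>\<^bsub>V\<^esub> ?g' W \<in> W"
      proof
        fix W assume W: "W \<in> F \<union> F'"
        then have "?g W \<in> W" "?g' W \<in> W" "W \<in> \<W>" using F F' inv[of W] by auto
        with inv[of W] show "?g W \<oplus>\<^bsub>V\<^esub> ?g' W \<in> W" by blast
      qed
    qed (use F F' in auto)
    finally show "v \<oplus>\<^bsub>V\<^esub> w \<in> sum_of_family \<W>" .
  next
    fix c v assume "v \<in> sum_of_family \<W>"
    then obtain F f where F: "v = (\<Oplus>\<^bsub>V\<^esub>W\<in>F. f W)" "finite F" "F \<subseteq> \<W>" "\<forall>W\<in>F. f W \<in> W"
      by (auto simp: sum_of_family_def)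
    then have "c \<odot>\<^bsub>V\<^esub> v = (\<Oplus>\<^bsub>V\<^esub>W\<in>F. c \<odot>\<^bsub>V\<^esub> f W)"
      using carr[of _ F f] by (auto intro!: V.finsum_smult_ldistr)
    then show "c \<odot>\<^bsub>V\<^esub> v \<in> sum_of_family \<W>"
      using F inv by (auto intro!: I)
  next
    fix s v assume s: "s \<in> carrier S" and "v \<in> sum_of_family \<W>"
    then obtain F f where F: "v = (\<Oplus>\<^bsub>V\<^esub>W\<in>F. f W)" "finite F" "F \<subseteq> \<W>" "\<forall>W\<in>F. f W \<in> W"
      by (auto simp: sum_of_family_def)
    then have "act s v = (\<Oplus>\<^bsub>V\<^esub>W\<in>F. act s (f W))"
      using carr[of _ F f] s by (auto intro!: act_finsum)
    then show "act s v \<in> sum_of_family \<W>"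
      using F inv s by (auto intro!: I)
  qed
qed

lemma subset_sum_of_family:
  assumes "W \<in> \<W>" "W \<subseteq> carrier V"
  shows "W \<subseteq> sum_of_family \<W>"
proof
  fix w assume "w \<in> W"
  then show "w \<in> sum_of_family \<W>"
    unfolding sum_of_family_def using assms
    by (auto intro!: exI[of _ "{W}"] exI[of _ "\<lambda>_. w"])
qed

text \<open>In a vanishing sum the component in \<open>W\<close> is the negative of the others, so
  it lies in the intersection and is zero; what remains is a relation in the old family.\<close>

lemma independent_insert:
  assumes ind: "independent \<W>" and inv: "\<And>W. W \<in> \<W> \<Longrightarrow> invariant_submodule S V act W"
    and W: "invariant_submodule S V act W" "W \<inter> sum_of_family \<W> = {\<zero>\<^bsub>V\<^esub>}"
  shows "independent (insert W \<W>)"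
  unfolding independent_def
proof (intro allI impI)
  fix F f
  assume F: "finite F \<and> F \<subseteq> insert W \<W> \<and> (\<forall>W\<in>F. f W \<in> W) \<and> (\<Oplus>\<^bsub>V\<^esub>W\<in>F. f W) = \<zero>\<^bsub>V\<^esub>"
  show "\<forall>W\<in>F. f W = \<zero>\<^bsub>V\<^esub>"
  proof (cases "W \<in> F")
    case False
    with F ind show ?thesis by (auto simp: independent_def)
  next
    case True
    define F0 where "F0 = F - {W}"
    have F0: "F = insert W F0" "W \<notin> F0" "finite F0" "F0 \<subseteq> \<W>" "\<forall>W\<in>F0. f W \<in> W" "f W \<in> W"
      using True F by (auto simp: F0_def)
    have carr: "f Y \<in> carrier V" if "Y \<in> F0" for Y
      using inv[of Y] F0 that unfolding invariant_submodule_iff by blast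
    have carrW: "f W \<in> carrier V" using W(1) F0(6) unfolding invariant_submodule_iff by blast
    define w where "w = (\<Oplus>\<^bsub>V\<^esub>W\<in>F0. f W)"
    have w: "w \<in> sum_of_family \<W>" "w \<in> carrier V"
      using F0 carr by (auto simp: sum_of_family_def w_def)
    have "f W \<oplus>\<^bsub>V\<^esub> w = \<zero>\<^bsub>V\<^esub>"
      using F F0 carr carrW by (auto simp: w_def Pi_iff)
    then have "f W = (- 1) \<odot>\<^bsub>V\<^esub> w"
      using w carrW minus_one_smult[of w] V.minus_equality[of "f W" w] by simp
    then have "f W \<in> sum_of_family \<W>"
      using w sum_of_family_invariant[OF inv] unfolding invariant_submodule_iff by simp
    then have fW: "f W = \<zero>\<^bsub>V\<^esub>" using W(2) F0 by auto
    then have "w = \<zero>\<^bsub>V\<^esub>" using \<open>f W \<oplus>\<^bsub>V\<^esub> w = \<zero>\<^bsub>V\<^esub>\<close> w by simp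
    then show ?thesis
      using ind F0 fW unfolding independent_def w_def by auto
  qed
qed

text \<open>The two expansions may have different supports. Summed over the union of both and
  subtracted, they give a relation that independence kills term by term.\<close>

lemma independent_expansion_unique:
  assumes ind: "independent \<W>" and inv: "\<And>W. W \<in> \<W> \<Longrightarrow> invariant_submodule S V act W"
    and f: "f \<in> (\<Pi>\<^sub>E W\<in>\<W>. W)" "finite {W\<in>\<W>. f W \<noteq> \<zero>\<^bsub>V\<^esub>}"
    and g: "g \<in> (\<Pi>\<^sub>E W\<in>\<W>. W)" "finite {W\<in>\<W>. g W \<noteq> \<zero>\<^bsub>V\<^esub>}"
    and eq: "(\<Oplus>\<^bsub>V\<^esub>W\<in>{W\<in>\<W>. f W \<noteq> \<zero>\<^bsub>V\<^esub>}. f W) = (\<Oplus>\<^bsub>V\<^esub>W\<in>{W\<in>\<W>. g W \<noteq> \<zero>\<^bsub>V\<^esub>}. g W)"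
  shows "f = g"
proof -
  define F where "F = {W\<in>\<W>. f W \<noteq> \<zero>\<^bsub>V\<^esub>} \<union> {W\<in>\<W>. g W \<noteq> \<zero>\<^bsub>V\<^esub>}"
  have F: "finite F" "F \<subseteq> \<W>" using f g by (auto simp: F_def)
  have mem: "f W \<in> W" "g W \<in> W" "f W \<in> carrier V" "g W \<in> carrier V" if "W \<in> \<W>" for W
    using f(1) g(1) that inv[OF that] unfolding invariant_submodule_iff by (auto simp: PiE_iff)
  have sums: "(\<Oplus>\<^bsub>V\<^esub>W\<in>{W\<in>\<W>. f W \<noteq> \<zero>\<^bsub>V\<^esub>}. f W) = (\<Oplus>\<^bsub>V\<^esub>W\<in>F. f W)"
    "(\<Oplus>\<^bsub>V\<^esub>W\<in>{W\<in>\<W>. g W \<noteq> \<zero>\<^bsub>V\<^esub>}. g W) = (\<Oplus>\<^bsub>V\<^esub>W\<in>F. g W)"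
    using F mem by (intro V.add.finprod_mono_neutral_cong_left; auto simp: F_def)+
  have neg: "(- 1) \<odot>\<^bsub>V\<^esub> (\<Oplus>\<^bsub>V\<^esub>W\<in>F. g W) = (\<Oplus>\<^bsub>V\<^esub>W\<in>F. (- 1) \<odot>\<^bsub>V\<^esub> g W)"
    using F mem by (intro V.finsum_smult_ldistr) auto
  have "(\<Oplus>\<^bsub>V\<^esub>W\<in>F. f W \<oplus>\<^bsub>V\<^esub> (- 1) \<odot>\<^bsub>V\<^esub> g W) = (\<Oplus>\<^bsub>V\<^esub>W\<in>F. f W) \<oplus>\<^bsub>V\<^esub> (- 1) \<odot>\<^bsub>V\<^esub> (\<Oplus>\<^bsub>V\<^esub>W\<in>F. g W)"
    unfolding neg using F mem by (intro V.finsum_addf) auto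
  also have "\<dots> = \<zero>\<^bsub>V\<^esub>"
  proof -
    have "(\<Oplus>\<^bsub>V\<^esub>W\<in>F. g W) \<in> carrier V" using F mem by (auto intro!: V.finsum_closed)
    then show ?thesis
      using eq sums by (simp add: V.r_neg minus_one_smult)
  qed
  finally have "\<forall>W\<in>F. f W \<oplus>\<^bsub>V\<^esub> (- 1) \<odot>\<^bsub>V\<^esub> g W = \<zero>\<^bsub>V\<^esub>"
  proof -
    assume "(\<Oplus>\<^bsub>V\<^esub>W\<in>F. f W \<oplus>\<^bsub>V\<^esub> (- 1) \<odot>\<^bsub>V\<^esub> g W) = \<zero>\<^bsub>V\<^esub>"
    moreover have "\<forall>W\<in>F. f W \<oplus>\<^bsub>V\<^esub> (- 1) \<odot>\<^bsub>V\<^esub> g W \<in> W"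
      using inv F mem unfolding invariant_submodule_iff by (meson subsetD)
    ultimately show ?thesis
      using F by (intro independentD[OF ind]) 
  qed
  then have "f W = g W" if "W \<in> F" for W
  proof -
    have W: "f W \<in> carrier V" "g W \<in> carrier V" using that F mem by auto
    have "f W \<oplus>\<^bsub>V\<^esub> (- 1) \<odot>\<^bsub>V\<^esub> g W = \<zero>\<^bsub>V\<^esub>"
      using \<open>\<forall>W\<in>F. _\<close> that by blast
    then show ?thesis
      using W V.minus_equality[of "f W" "\<ominus>\<^bsub>V\<^esub> g W"] by (simp add: minus_one_smult)
  qed
  then have "f W = g W" if "W \<in> \<W>" for W
    using that by (cases "W \<in> F") (auto simp: F_def)
  then show ?thesis using f(1) g(1) by (intro PiE_ext) auto
qed

text \<open>A simple submodule not inside the sum of an independent family meets that sum in zero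
  and can be added to the family, so a maximal family has everything as its sum. The hypothesis on
  \<open>T\<close> says that the simple submodules generate \<open>V\<close>, without exhibiting any
  sum.\<close>

lemma completely_reducible_if_sum_of_simples:
  assumes sum: "\<And>T. invariant_submodule S V act T \<Longrightarrow>
    (\<And>W. simple_submodule S V act W \<Longrightarrow> W \<subseteq> T) \<Longrightarrow> T = carrier V"
  shows "completely_reducible S V act"
proof -
  note simple_iff = simple_submodule_iff[OF monoid_module_axioms]
  define \<A> where "\<A> = {\<W>. (\<forall>W\<in>\<W>. simple_submodule S V act W) \<and> independent \<W>}"
  have "{} \<in> \<A>" by (simp add: \<A>_def independent_def)
  \<comment> \<open>Independence tests finite subfamilies only, and a finite subset of the union of
    a chain already lies in one member.\<close>
  moreover have "\<Union>\<C> \<in> \<A>" if \<C>: "\<C> \<noteq> {}" "subset.chain \<A> \<C>" for \<C>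
  proof -
    have sub: "\<C> \<subseteq> \<A>" using \<C> by (auto simp: subset.chain_def)
    have "independent (\<Union>\<C>)"
      unfolding independent_def
    proof (intro allI impI)
      fix F f assume F: "finite F \<and> F \<subseteq> \<Union>\<C> \<and> (\<forall>W\<in>F. f W \<in> W) \<and> (\<Oplus>\<^bsub>V\<^esub>W\<in>F. f W) = \<zero>\<^bsub>V\<^esub>"
      then obtain \<W> where "\<W> \<in> \<C>" "F \<subseteq> \<W>"
        using finite_subset_Union_chain[of F \<C> \<A>] \<C> by blast
      moreover have "independent \<W>" using sub \<open>\<W> \<in> \<C>\<close> by (auto simp: \<A>_def)
      ultimately show "\<forall>W\<in>F. f W = \<zero>\<^bsub>V\<^esub>" using F unfolding independent_def by blast
    qed
    then show ?thesis using sub by (auto simp: \<A>_def)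
  qed
  ultimately obtain \<W> where "\<W> \<in> \<A>" and max: "\<And>\<Y>. \<Y> \<in> \<A> \<Longrightarrow> \<W> \<subseteq> \<Y> \<Longrightarrow> \<Y> = \<W>"
    using subset_Zorn_nonempty[of \<A>] by blast
  then have simple: "simple_submodule S V act W" and inv: "invariant_submodule S V act W"
    if "W \<in> \<W>" for W
    using that by (auto simp: \<A>_def simple_submodule_def)
  have ind: "independent \<W>" using \<open>\<W> \<in> \<A>\<close> by (simp add: \<A>_def)
  have "sum_of_family \<W> = carrier V"
  proof (rule sum)
    show invsum: "invariant_submodule S V act (sum_of_family \<W>)"
      using inv by (rule sum_of_family_invariant)
    fix W assume W: "simple_submodule S V act W"
    then have invW: "invariant_submodule S V act W" by (simp add: simple_submodule_def)
    have "invariant_submodule S V act (W \<inter> sum_of_family \<W>)"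
      using invW invsum unfolding invariant_submodule_iff by blast
    then consider "W \<inter> sum_of_family \<W> = {\<zero>\<^bsub>V\<^esub>}" | "W \<inter> sum_of_family \<W> = W"
      using W unfolding simple_iff by blast
    then show "W \<subseteq> sum_of_family \<W>"
    proof cases
      case 1
      then have "insert W \<W> \<in> \<A>"
        using independent_insert[OF ind inv invW] W simple by (simp add: \<A>_def)
      then have "W \<in> \<W>" using max by blast
      then show ?thesis
        using invW by (intro subset_sum_of_family) (auto simp: invariant_submodule_iff)
    qed blast
  qed
  have "\<exists>!f. f \<in> (\<Pi>\<^sub>E W\<in>\<W>. W) \<and> finite {W\<in>\<W>. f W \<noteq> \<zero>\<^bsub>V\<^esub>} \<and>
        v = (\<Oplus>\<^bsub>V\<^esub>W\<in>{W\<in>\<W>. f W \<noteq> \<zero>\<^bsub>V\<^esub>}. f W)" if "v \<in> carrier V" for v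
  proof -
    have v: "v \<in> sum_of_family \<W>" using that \<open>sum_of_family \<W> = carrier V\<close> by simp
    obtain F f where F: "v = (\<Oplus>\<^bsub>V\<^esub>W\<in>F. f W)" "finite F" "F \<subseteq> \<W>" "\<forall>W\<in>F. f W \<in> W"
      using v unfolding sum_of_family_def by fast
    \<comment> \<open>Zero off \<open>F\<close> and undefined off \<open>\<W>\<close>: the required
      expansion is an extensional function on the whole family.\<close>
    define g where "g = (\<lambda>W\<in>\<W>. if W \<in> F then f W else \<zero>\<^bsub>V\<^esub>)"
    have supp: "{W\<in>\<W>. g W \<noteq> \<zero>\<^bsub>V\<^esub>} \<subseteq> F" by (auto simp: g_def)
    have "f W \<in> carrier V" if "W \<in> F" for W
      using F that inv[of W] unfolding invariant_submodule_iff by blast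
    then have "v = (\<Oplus>\<^bsub>V\<^esub>W\<in>{W\<in>\<W>. g W \<noteq> \<zero>\<^bsub>V\<^esub>}. g W)"
      unfolding F(1) using F(2-) supp
      by (intro V.add.finprod_mono_neutral_cong_right) (auto simp: g_def)
    moreover have "g \<in> (\<Pi>\<^sub>E W\<in>\<W>. W)"
      using F inv by (auto simp: g_def invariant_submodule_iff)
    moreover have "finite {W\<in>\<W>. g W \<noteq> \<zero>\<^bsub>V\<^esub>}" using F(2) supp by (rule rev_finite_subset)
    moreover have "h = g" if h: "h \<in> (\<Pi>\<^sub>E W\<in>\<W>. W)" "finite {W\<in>\<W>. h W \<noteq> \<zero>\<^bsub>V\<^esub>}"
      and "v = (\<Oplus>\<^bsub>V\<^esub>W\<in>{W\<in>\<W>. h W \<noteq> \<zero>\<^bsub>V\<^esub>}. h W)" for h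
      by (rule independent_expansion_unique[OF ind inv h])
        (use calculation that in \<open>simp_all only:\<close>)
    ultimately show ?thesis by (intro ex1I[of _ g] conjI) (assumption | elim conjE)+
  qed
  moreover have "\<forall>W\<in>\<W>. invariant_submodule S V act W \<and> simple_module S (V\<lparr>carrier := W\<rparr>) act"
    using simple by (auto simp: simple_submodule_def)
  ultimately show ?thesis
    unfolding completely_reducible_def by (intro conjI monoid_module_axioms exI[of _ \<W>] ballI) simp_all
qed

end

section \<open>Free modules and quotients\<close>

lemma lookup_scale [simp]: "Poly_Mapping.lookup (Poly_Mapping.map ((*) (c::complex)) f) x = c * Poly_Mapping.lookup f x"
  by (simp add: Poly_Mapping.map.rep_eq when_def)

lemma scale_add: "Poly_Mapping.map ((*) (c::complex)) (f + g) = Poly_Mapping.map ((*) c) f + Poly_Mapping.map ((*) c) g"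
  by (rule poly_mapping_eqI) (simp add: lookup_add algebra_simps)

lemma add_scale: "Poly_Mapping.map ((*) (c + d :: complex)) f = Poly_Mapping.map ((*) c) f + Poly_Mapping.map ((*) d) f"
  by (rule poly_mapping_eqI) (simp add: lookup_add algebra_simps)

lemma scale_scale: "Poly_Mapping.map ((*) (c * d :: complex)) f = Poly_Mapping.map ((*) c) (Poly_Mapping.map ((*) d) f)"
  by (rule poly_mapping_eqI) simp

lemma scale_one: "Poly_Mapping.map ((*) (1 :: complex)) f = f"
  by (rule poly_mapping_eqI) simp

lemma scale_zero: "Poly_Mapping.map ((*) (0 :: complex)) f = 0"
  by (rule poly_mapping_eqI) simp

lemma scale_single: "Poly_Mapping.map ((*) (c :: complex)) (Poly_Mapping.single b d) = Poly_Mapping.single b (c * d)"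
  by (rule poly_mapping_eqI) (simp add: lookup_single when_def)

lemma keys_scale_subset: "Poly_Mapping.keys (Poly_Mapping.map ((*) (c :: complex)) f) \<subseteq> Poly_Mapping.keys f"
  by (auto simp: in_keys_iff)

lemma keys_diff_closed: "Poly_Mapping.keys f \<subseteq> B \<Longrightarrow> Poly_Mapping.keys g \<subseteq> B \<Longrightarrow> Poly_Mapping.keys (f - g :: 'b \<Rightarrow>\<^sub>0 complex) \<subseteq> B"
  by (simp add: in_keys_iff lookup_minus subset_iff) (metis diff_self)

lemma keys_single_closed: "b \<in> B \<Longrightarrow> Poly_Mapping.keys (Poly_Mapping.single b (c :: complex)) \<subseteq> B"
  by simp

lemma free_module_simps [simp]:
  "f \<in> carrier (free_module B) \<longleftrightarrow> Poly_Mapping.keys f \<subseteq> B"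
  "\<zero>\<^bsub>free_module B\<^esub> = 0" "f \<oplus>\<^bsub>free_module B\<^esub> g = f + g"
  "c \<odot>\<^bsub>free_module B\<^esub> f = Poly_Mapping.map ((*) c) f"
  by (simp_all add: free_module_def)

lemma module_free_module: "module complex_ring (free_module B)"
proof (rule moduleI)
  show "abelian_group (free_module B)"
  proof (rule abelian_groupI)
    fix f assume "f \<in> carrier (free_module B)"
    then show "\<exists>g\<in>carrier (free_module B). g \<oplus>\<^bsub>free_module B\<^esub> f = \<zero>\<^bsub>free_module B\<^esub>"
      by (intro bexI[of _ "- f"]) (auto simp: in_keys_iff)
  qed (use Poly_Mapping.keys_add in \<open>auto simp: add_ac\<close>, fastforce)
qed (use cring_from_type_algebra keys_scale_subset in
  \<open>fastforce simp: scale_add add_scale scale_scale scale_one\<close>)+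

lemma free_module_minus [simp]:
  assumes "Poly_Mapping.keys f \<subseteq> B"
  shows "\<ominus>\<^bsub>free_module B\<^esub> f = - f"
proof -
  interpret module complex_ring "free_module B" by (rule module_free_module)
  show ?thesis
    using assms by (intro minus_equality) (auto simp: in_keys_iff)
qed

text \<open>The defining sum runs over the support, which changes with the argument. A common finite
  index set makes linearity a termwise computation.\<close>

lemma linear_extension_superset:
  assumes "finite A" "Poly_Mapping.keys f \<subseteq> A"
  shows "linear_extension h f = (\<Sum>b\<in>A. Poly_Mapping.map ((*) (Poly_Mapping.lookup f b)) (h b))"
  unfolding linear_extension_def
  using assms by (intro sum.mono_neutral_left) (auto simp: in_keys_iff scale_zero)

lemma linear_extension_add: "linear_extension h (f + g) = linear_extension h f + linear_extension h g"
proof -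
  have "linear_extension h x = (\<Sum>b\<in>Poly_Mapping.keys f \<union> Poly_Mapping.keys g. Poly_Mapping.map ((*) (Poly_Mapping.lookup x b)) (h b))"
    if "x \<in> {f, g, f + g}" for x
    using that Poly_Mapping.keys_add[of f g] by (intro linear_extension_superset) auto
  then show ?thesis
    by (simp add: lookup_add add_scale sum.distrib)
qed

lemma linear_extension_scale:
  "linear_extension h (Poly_Mapping.map ((*) c) f) = Poly_Mapping.map ((*) c) (linear_extension h f)"
proof -
  have "linear_extension h (Poly_Mapping.map ((*) c) f) = (\<Sum>b\<in>Poly_Mapping.keys f. Poly_Mapping.map ((*) (c * Poly_Mapping.lookup f b)) (h b))"
    using keys_scale_subset[of c f] by (subst linear_extension_superset[of "Poly_Mapping.keys f"]) auto
  also have "\<dots> = Poly_Mapping.map ((*) c) (linear_extension h f)"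
    by (rule poly_mapping_eqI) (simp add: linear_extension_def lookup_sum sum_distrib_left mult.assoc)
  finally show ?thesis .
qed

lemma linear_extension_single [simp]:
  "linear_extension h (Poly_Mapping.single b c) = Poly_Mapping.map ((*) c) (h b)"
  by (subst linear_extension_superset[of "{b}"]) auto

lemma linear_extension_minus: "linear_extension h (f - g) = linear_extension h f - linear_extension h g"
  using linear_extension_add[of h "f - g" g] by simp

lemma linear_extension_cong:
  "(\<And>b. b \<in> Poly_Mapping.keys f \<Longrightarrow> h b = k b) \<Longrightarrow> linear_extension h f = linear_extension k f"
  by (simp add: linear_extension_def)

lemma linear_extension_basis [simp]: "linear_extension (\<lambda>b. Poly_Mapping.single b 1) f = f"
proof (rule poly_mapping_eqI)
  fix x
  show "Poly_Mapping.lookup (linear_extension (\<lambda>b. Poly_Mapping.single b 1) f) x = Poly_Mapping.lookup f x"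
    by (auto simp: linear_extension_def lookup_sum lookup_single when_def sum.delta if_distrib in_keys_iff
        cong: if_cong)
qed

lemma linear_extension_in_submodule:
  assumes "submodule N complex_ring (free_module C)" "Poly_Mapping.keys f \<subseteq> B" "\<And>b. b \<in> B \<Longrightarrow> h b \<in> N"
  shows "linear_extension h f \<in> N"
proof -
  have N: "0 \<in> N" "\<And>u v. u \<in> N \<Longrightarrow> v \<in> N \<Longrightarrow> u + v \<in> N" "\<And>c u. u \<in> N \<Longrightarrow> Poly_Mapping.map ((*) c) u \<in> N"
    using assms(1) by (auto simp: submodule_iff[OF module_free_module])
  have "(\<Sum>b\<in>A. Poly_Mapping.map ((*) (Poly_Mapping.lookup f b)) (h b)) \<in> N" if "finite A" "A \<subseteq> B" for A
    using that by (induction A rule: finite_induct) (auto intro!: N assms(3))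
  then show ?thesis using assms(2) by (simp add: linear_extension_def)
qed

lemma linear_extension_closed:
  assumes "Poly_Mapping.keys f \<subseteq> B" "\<And>b. b \<in> B \<Longrightarrow> Poly_Mapping.keys (h b) \<subseteq> C"
  shows "Poly_Mapping.keys (linear_extension h f) \<subseteq> C"
  using linear_extension_in_submodule[OF module.carrier_is_submodule[OF module_free_module], of f B h C] assms
  by simp

lemma linear_extension_comp:
  fixes f :: "'a \<Rightarrow>\<^sub>0 complex"
  shows "linear_extension k (linear_extension h f) = linear_extension (\<lambda>b. linear_extension k (h b)) f"
proof -
  have "linear_extension k (\<Sum>b\<in>A. g b) = (\<Sum>b\<in>A. linear_extension k (g b))" if "finite A"
    for A :: "'a set" and g
    using that
    by (induction A rule: finite_induct) (simp_all add: linear_extension_add, simp add: linear_extension_def)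
  then show ?thesis
    by (simp add: linear_extension_def[of h] linear_extension_scale)
      (simp add: linear_extension_def[of "\<lambda>b. linear_extension k (h b)"])
qed

text \<open>Acts as an induction principle: a linear property of vectors cuts out a submodule, and
  only basis vectors remain to be tested.\<close>

lemma free_module_submodule_eq:
  assumes "submodule N complex_ring (free_module B)" "\<And>b. b \<in> B \<Longrightarrow> Poly_Mapping.single b 1 \<in> N"
  shows "N = carrier (free_module B)"
proof
  show "N \<subseteq> carrier (free_module B)"
    using assms(1) by (simp add: submodule_iff[OF module_free_module])
  show "carrier (free_module B) \<subseteq> N"
  proof
    fix f :: "'a \<Rightarrow>\<^sub>0 complex" assume "f \<in> carrier (free_module B)"
    then have "linear_extension (\<lambda>b. Poly_Mapping.single b 1) f \<in> N"
      using assms by (intro linear_extension_in_submodule) auto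
    then show "f \<in> N" by simp
  qed
qed

section \<open>Generated submodules and quotient modules\<close>

lemma generated_submodule_submodule:
  assumes "module complex_ring V" "E \<subseteq> carrier V"
  shows "submodule (generated_submodule V E) complex_ring V"
proof -
  interpret module complex_ring V by fact
  have "submodule (carrier V) complex_ring V" by (rule carrier_is_submodule)
  then show ?thesis
    using assms unfolding submodule_iff[OF assms(1)] generated_submodule_def by blast
qed

lemma generated_submodule_subset: "E \<subseteq> generated_submodule V E"
  by (auto simp: generated_submodule_def)

lemma generated_submodule_minimal:
  "submodule N complex_ring V \<Longrightarrow> E \<subseteq> N \<Longrightarrow> generated_submodule V E \<subseteq> N"
  by (auto simp: generated_submodule_def)

locale module_quotient = module complex_ring V for V :: "(complex, 'v, 'f) module_scheme" +
  fixes N :: "'v set"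
  assumes submodule: "submodule N complex_ring V"
begin

sublocale abelian_subgroup N V
  using submodule.axioms(1)[OF submodule] a_comm_group by (rule abelian_subgroupI2[rotated])

text \<open>Scalar multiplication on the quotient and \<open>tensor_map\<close> are unions over all
  members of a coset, which avoids choosing a representative. The union collapses because
  \<open>h\<close> is additive and preserves \<open>N\<close>, so that every member yields the same
  coset.\<close>

lemma coset_map:
  assumes "\<And>u. u \<in> carrier V \<Longrightarrow> h u \<in> carrier V"
    and "\<And>u v. u \<in> carrier V \<Longrightarrow> v \<in> carrier V \<Longrightarrow> h (u \<oplus>\<^bsub>V\<^esub> v) = h u \<oplus>\<^bsub>V\<^esub> h v"
    and "\<And>n. n \<in> N \<Longrightarrow> h n \<in> N" and v: "v \<in> carrier V"
  shows "(\<Union>u\<in>N +>\<^bsub>V\<^esub> v. N +>\<^bsub>V\<^esub> h u) = N +>\<^bsub>V\<^esub> h v"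
proof -
  have "N +>\<^bsub>V\<^esub> h u = N +>\<^bsub>V\<^esub> h v" if u: "u \<in> N +>\<^bsub>V\<^esub> v" for u
  proof -
    obtain n where "n \<in> N" "u = n \<oplus>\<^bsub>V\<^esub> v" using u by (auto simp: a_r_coset_def')
    then have "h u = h n \<oplus>\<^bsub>V\<^esub> h v" "h n \<in> N" using assms a_subset by auto
    then show ?thesis
      using assms a_subset a_subgroup
      by (metis a_coset_add_assoc a_coset_join2 subset_iff)
  qed
  then show ?thesis using a_rcos_self[OF v] by blast
qed

lemma quotient_carrier: "carrier (quotient_module V N) = {N +>\<^bsub>V\<^esub> v | v. v \<in> carrier V}"
  by (auto simp: quotient_module_def A_RCOSETS_def')

lemma quotient_zero: "\<zero>\<^bsub>quotient_module V N\<^esub> = N +>\<^bsub>V\<^esub> \<zero>\<^bsub>V\<^esub>"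
  using a_subset by (simp add: quotient_module_def)

lemma quotient_add:
  "v \<in> carrier V \<Longrightarrow> w \<in> carrier V \<Longrightarrow>
    (N +>\<^bsub>V\<^esub> v) \<oplus>\<^bsub>quotient_module V N\<^esub> (N +>\<^bsub>V\<^esub> w) = N +>\<^bsub>V\<^esub> (v \<oplus>\<^bsub>V\<^esub> w)"
  by (simp add: quotient_module_def a_rcos_sum)

lemma quotient_smult:
  "v \<in> carrier V \<Longrightarrow> c \<odot>\<^bsub>quotient_module V N\<^esub> (N +>\<^bsub>V\<^esub> v) = N +>\<^bsub>V\<^esub> (c \<odot>\<^bsub>V\<^esub> v)"
  using coset_map[of "\<lambda>u. c \<odot>\<^bsub>V\<^esub> u" v] submodule
  by (simp add: quotient_module_def smult_r_distr submodule_iff[OF module_axioms])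

lemma quotient_in_carrier [simp]: "v \<in> carrier V \<Longrightarrow> N +>\<^bsub>V\<^esub> v \<in> carrier (quotient_module V N)"
  by (auto simp: quotient_carrier)

lemma quotient_eqI:
  assumes "v \<in> carrier V" "w \<in> carrier V" "v \<ominus>\<^bsub>V\<^esub> w \<in> N"
  shows "N +>\<^bsub>V\<^esub> v = N +>\<^bsub>V\<^esub> w"
  using assms a_coset_join2[of "v \<ominus>\<^bsub>V\<^esub> w"] a_subset a_subgroup
  by (simp add: a_minus_def a_coset_add_inv1)

lemma module_quotient_module: "module complex_ring (quotient_module V N)"
proof (rule moduleI)
  show "cring complex_ring" by (rule cring_from_type_algebra)
  show "abelian_group (quotient_module V N)"
  proof (rule abelian_groupI)
    fix C assume "C \<in> carrier (quotient_module V N)"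
    then obtain v where "C = N +>\<^bsub>V\<^esub> v" "v \<in> carrier V" by (auto simp: quotient_carrier)
    then show "\<exists>D\<in>carrier (quotient_module V N). D \<oplus>\<^bsub>quotient_module V N\<^esub> C = \<zero>\<^bsub>quotient_module V N\<^esub>"
      by (intro bexI[of _ "N +>\<^bsub>V\<^esub> (\<ominus>\<^bsub>V\<^esub> v)"]) (simp_all add: quotient_add quotient_zero l_neg)
  qed (auto simp: quotient_carrier quotient_add quotient_zero M.a_ac)
qed (auto simp: quotient_carrier quotient_add quotient_smult smult_r_distr smult_assoc1
    smult_l_distr[simplified] smult_assoc1[simplified] smult_one[simplified])

text \<open>Carries a submodule of the quotient back to representatives, where
  \<open>free_module_submodule_eq\<close> can be applied.\<close>

lemma quotient_preimage:
  assumes "submodule Q complex_ring (quotient_module V N)"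
  shows "submodule {v \<in> carrier V. N +>\<^bsub>V\<^esub> v \<in> Q} complex_ring V"
  using assms
  by (simp add: submodule_iff[OF module_axioms] submodule_iff[OF module_quotient_module]
      quotient_zero quotient_add[symmetric] quotient_smult[symmetric])

end

section \<open>Tensor products\<close>

definition linear_endo :: "(complex, 'v, 'f) module_scheme \<Rightarrow> ('v \<Rightarrow> 'v) \<Rightarrow> bool"
  where "linear_endo V f \<longleftrightarrow> (\<forall>v\<in>carrier V. f v \<in> carrier V) \<and>
    (\<forall>v\<in>carrier V. \<forall>w\<in>carrier V. f (v \<oplus>\<^bsub>V\<^esub> w) = f v \<oplus>\<^bsub>V\<^esub> f w) \<and>
    (\<forall>c. \<forall>v\<in>carrier V. f (c \<odot>\<^bsub>V\<^esub> v) = c \<odot>\<^bsub>V\<^esub> f v)"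

lemma linear_endo_id: "linear_endo V id"
  by (simp add: linear_endo_def)

lemma (in monoid_module) linear_endo_act: "s \<in> carrier S \<Longrightarrow> linear_endo V (act s)"
  by (simp add: linear_endo_def act_closed act_add act_smult)

text \<open>The parameter \<open>E\<close> lets the same lemmas serve twice: with the balanced
  relations for L(H, X), and with \<open>{}\<close> for the tensor product of two such modules over
  the complex numbers.\<close>

locale tensor_product = V: module complex_ring V + W: module complex_ring W
  for V :: "(complex, 'v, 'f) module_scheme" and W :: "(complex, 'w, 'g) module_scheme" +
  fixes E :: "('v \<times> 'w \<Rightarrow>\<^sub>0 complex) set"
  assumes relations_closed: "E \<subseteq> carrier (free_module (carrier V \<times> carrier W))"
begin

abbreviation F where "F \<equiv> free_module (carrier V \<times> carrier W)"
abbreviation K where "K \<equiv> tensor_kernel V W E"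

lemma bilinear_relations_cases:
  assumes "r \<in> bilinear_relations V W"
  obtains
    (add_left) v v' w where "v \<in> carrier V" "v' \<in> carrier V" "w \<in> carrier W" "r =
      Poly_Mapping.single (v \<oplus>\<^bsub>V\<^esub> v', w) 1 - Poly_Mapping.single (v, w) 1 - Poly_Mapping.single (v', w) 1"
  | (add_right) v w w' where "v \<in> carrier V" "w \<in> carrier W" "w' \<in> carrier W" "r =
      Poly_Mapping.single (v, w \<oplus>\<^bsub>W\<^esub> w') 1 - Poly_Mapping.single (v, w) 1 - Poly_Mapping.single (v, w') 1"
  | (smult_left) c v w where "v \<in> carrier V" "w \<in> carrier W" "r =
      Poly_Mapping.single (c \<odot>\<^bsub>V\<^esub> v, w) 1 - Poly_Mapping.single (v, w) c"
  | (smult_right) c v w where "v \<in> carrier V" "w \<in> carrier W" "r =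
      Poly_Mapping.single (v, c \<odot>\<^bsub>W\<^esub> w) 1 - Poly_Mapping.single (v, w) c"
  using assms unfolding bilinear_relations_def
  by (elim UnE CollectE exE conjE) (assumption | rule that)+

lemma bilinear_relationsI:
  "v \<in> carrier V \<Longrightarrow> v' \<in> carrier V \<Longrightarrow> w \<in> carrier W \<Longrightarrow>
    Poly_Mapping.single (v \<oplus>\<^bsub>V\<^esub> v', w) 1 - Poly_Mapping.single (v, w) 1 - Poly_Mapping.single (v', w) 1
    \<in> bilinear_relations V W"
  "v \<in> carrier V \<Longrightarrow> w \<in> carrier W \<Longrightarrow> w' \<in> carrier W \<Longrightarrow>
    Poly_Mapping.single (v, w \<oplus>\<^bsub>W\<^esub> w') 1 - Poly_Mapping.single (v, w) 1 - Poly_Mapping.single (v, w') 1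
    \<in> bilinear_relations V W"
  "v \<in> carrier V \<Longrightarrow> w \<in> carrier W \<Longrightarrow>
    Poly_Mapping.single (c \<odot>\<^bsub>V\<^esub> v, w) 1 - Poly_Mapping.single (v, w) c \<in> bilinear_relations V W"
  "v \<in> carrier V \<Longrightarrow> w \<in> carrier W \<Longrightarrow>
    Poly_Mapping.single (v, c \<odot>\<^bsub>W\<^esub> w) 1 - Poly_Mapping.single (v, w) c \<in> bilinear_relations V W"
  unfolding bilinear_relations_def
  by (rule UnI1, rule UnI1, rule UnI1, intro CollectI exI conjI, rule refl, assumption+)
    (rule UnI1, rule UnI1, rule UnI2, intro CollectI exI conjI, rule refl, assumption+,
     rule UnI1, rule UnI2, intro CollectI exI conjI, rule refl, assumption+,
     rule UnI2, intro CollectI exI conjI, rule refl, assumption+)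

lemma bilinear_relations_closed: "bilinear_relations V W \<subseteq> carrier F"
proof
  fix r assume "r \<in> bilinear_relations V W"
  then show "r \<in> carrier F"
    by (cases rule: bilinear_relations_cases; simp only: free_module_simps;
        intro keys_diff_closed keys_single_closed; simp)
qed

lemma kernel_submodule: "submodule K complex_ring F"
  unfolding tensor_kernel_def
  by (intro generated_submodule_submodule module_free_module Un_least
      bilinear_relations_closed relations_closed)

sublocale quot: module_quotient F K
  using module_free_module kernel_submodule
  by (intro module_quotient.intro module_quotient_axioms.intro)

lemma module_tensor_module: "module complex_ring (tensor_module V W E)"
  unfolding tensor_module_def by (rule quot.module_quotient_module)

lemma relation_in_kernel: "r \<in> bilinear_relations V W \<union> E \<Longrightarrow> r \<in> K"
  unfolding tensor_kernel_def by (rule subsetD[OF generated_submodule_subset])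

lemma kernel_subset_submodule:
  assumes "submodule N complex_ring F" "bilinear_relations V W \<subseteq> N" "E \<subseteq> N"
  shows "K \<subseteq> N"
  unfolding tensor_kernel_def by (intro generated_submodule_minimal Un_least assms)

section \<open>Pure tensors as generators\<close>

definition pure_tensor :: "'v \<Rightarrow> 'w \<Rightarrow> ('v \<times> 'w \<Rightarrow>\<^sub>0 complex) set"
  where "pure_tensor v w = K +>\<^bsub>F\<^esub> Poly_Mapping.single (v, w) 1"

lemma single_in_F [simp]: "v \<in> carrier V \<Longrightarrow> w \<in> carrier W \<Longrightarrow> Poly_Mapping.single (v, w) c \<in> carrier F"
  by (simp add: keys_single_closed del: keys_single)

lemma pure_tensor_closed:
  "v \<in> carrier V \<Longrightarrow> w \<in> carrier W \<Longrightarrow> pure_tensor v w \<in> carrier (tensor_module V W E)"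
  unfolding pure_tensor_def tensor_module_def by (intro quot.quotient_in_carrier single_in_F)

lemma coset_eqI:
  assumes "u \<in> carrier F" "u' \<in> carrier F" "u - u' \<in> bilinear_relations V W \<union> E"
  shows "K +>\<^bsub>F\<^esub> u = K +>\<^bsub>F\<^esub> u'"
  using assms relation_in_kernel[OF assms(3)]
  by (intro quot.quotient_eqI) (simp_all add: a_minus_def)

lemma pure_tensor_add_left:
  assumes "v \<in> carrier V" "v' \<in> carrier V" "w \<in> carrier W"
  shows "pure_tensor (v \<oplus>\<^bsub>V\<^esub> v') w = pure_tensor v w \<oplus>\<^bsub>tensor_module V W E\<^esub> pure_tensor v' w"
proof -
  have "K +>\<^bsub>F\<^esub> Poly_Mapping.single (v \<oplus>\<^bsub>V\<^esub> v', w) 1 =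
    K +>\<^bsub>F\<^esub> (Poly_Mapping.single (v, w) 1 \<oplus>\<^bsub>F\<^esub> Poly_Mapping.single (v', w) 1)"
    using assms by (intro coset_eqI quot.M.a_closed single_in_F)
      (auto simp: diff_diff_eq[symmetric] bilinear_relationsI)
  then show ?thesis
    using assms quot.quotient_add[OF single_in_F single_in_F] by (simp add: pure_tensor_def tensor_module_def)
qed

lemma pure_tensor_add_right:
  assumes "v \<in> carrier V" "w \<in> carrier W" "w' \<in> carrier W"
  shows "pure_tensor v (w \<oplus>\<^bsub>W\<^esub> w') = pure_tensor v w \<oplus>\<^bsub>tensor_module V W E\<^esub> pure_tensor v w'"
proof -
  have "K +>\<^bsub>F\<^esub> Poly_Mapping.single (v, w \<oplus>\<^bsub>W\<^esub> w') 1 =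
    K +>\<^bsub>F\<^esub> (Poly_Mapping.single (v, w) 1 \<oplus>\<^bsub>F\<^esub> Poly_Mapping.single (v, w') 1)"
    using assms by (intro coset_eqI quot.M.a_closed single_in_F)
      (auto simp: diff_diff_eq[symmetric] bilinear_relationsI)
  then show ?thesis
    using assms quot.quotient_add[OF single_in_F single_in_F] by (simp add: pure_tensor_def tensor_module_def)
qed

lemma pure_tensor_smult_left:
  assumes "v \<in> carrier V" "w \<in> carrier W"
  shows "pure_tensor (c \<odot>\<^bsub>V\<^esub> v) w = c \<odot>\<^bsub>tensor_module V W E\<^esub> pure_tensor v w"
proof -
  have "K +>\<^bsub>F\<^esub> Poly_Mapping.single (c \<odot>\<^bsub>V\<^esub> v, w) 1 = K +>\<^bsub>F\<^esub> Poly_Mapping.single (v, w) c"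
    using assms by (intro coset_eqI single_in_F) (auto simp: bilinear_relationsI)
  then show ?thesis
    using assms quot.quotient_smult[OF single_in_F, of v w c 1]
    by (simp add: pure_tensor_def tensor_module_def scale_single)
qed

lemma pure_tensor_smult_right:
  assumes "v \<in> carrier V" "w \<in> carrier W"
  shows "pure_tensor v (c \<odot>\<^bsub>W\<^esub> w) = c \<odot>\<^bsub>tensor_module V W E\<^esub> pure_tensor v w"
proof -
  have "K +>\<^bsub>F\<^esub> Poly_Mapping.single (v, c \<odot>\<^bsub>W\<^esub> w) 1 = K +>\<^bsub>F\<^esub> Poly_Mapping.single (v, w) c"
    using assms by (intro coset_eqI single_in_F) (auto simp: bilinear_relationsI)
  then show ?thesis
    using assms quot.quotient_smult[OF single_in_F, of v w c 1]
    by (simp add: pure_tensor_def tensor_module_def scale_single)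
qed

lemma pure_tensor_zero_left:
  assumes "w \<in> carrier W"
  shows "pure_tensor \<zero>\<^bsub>V\<^esub> w = \<zero>\<^bsub>tensor_module V W E\<^esub>"
proof -
  have "pure_tensor (0 \<odot>\<^bsub>V\<^esub> \<zero>\<^bsub>V\<^esub>) w = 0 \<odot>\<^bsub>tensor_module V W E\<^esub> pure_tensor \<zero>\<^bsub>V\<^esub> w"
    by (intro pure_tensor_smult_left V.M.zero_closed assms)
  then show ?thesis
    using assms V.smult_l_null[of "\<zero>\<^bsub>V\<^esub>"]
      module.smult_l_null[OF module_tensor_module pure_tensor_closed, of "\<zero>\<^bsub>V\<^esub>" w]
    by simp
qed

lemma pure_tensor_zero_right:
  assumes "v \<in> carrier V"
  shows "pure_tensor v \<zero>\<^bsub>W\<^esub> = \<zero>\<^bsub>tensor_module V W E\<^esub>"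
proof -
  have "pure_tensor v (0 \<odot>\<^bsub>W\<^esub> \<zero>\<^bsub>W\<^esub>) = 0 \<odot>\<^bsub>tensor_module V W E\<^esub> pure_tensor v \<zero>\<^bsub>W\<^esub>"
    by (intro pure_tensor_smult_right W.M.zero_closed assms)
  then show ?thesis
    using assms W.smult_l_null[of "\<zero>\<^bsub>W\<^esub>"]
      module.smult_l_null[OF module_tensor_module pure_tensor_closed, of v "\<zero>\<^bsub>W\<^esub>"]
    by simp
qed

lemma tensor_submodule_eq:
  assumes Q: "submodule Q complex_ring (tensor_module V W E)"
    and pure: "\<And>v w. v \<in> carrier V \<Longrightarrow> w \<in> carrier W \<Longrightarrow> pure_tensor v w \<in> Q"
  shows "Q = carrier (tensor_module V W E)"
proof
  show "Q \<subseteq> carrier (tensor_module V W E)"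
    using Q by (simp add: submodule_iff[OF module_tensor_module])
  have "{u \<in> carrier F. K +>\<^bsub>F\<^esub> u \<in> Q} = carrier F"
    using Q single_in_F pure unfolding pure_tensor_def
    by (intro free_module_submodule_eq quot.quotient_preimage) (auto simp: tensor_module_def)
  then show "carrier (tensor_module V W E) \<subseteq> Q"
    by (auto simp: tensor_module_def quot.quotient_carrier)
qed

text \<open>One factor at a time: for a generator \<open>v\<close> in \<open>A\<close>, the good
  \<open>w\<close> form a submodule containing \<open>B\<close>, hence all of \<open>W\<close>; for
  an arbitrary \<open>w\<close>, the good \<open>v\<close> then form a submodule containing
  \<open>A\<close>.\<close>

lemma tensor_submodule_eq_generators:
  assumes Q: "submodule Q complex_ring (tensor_module V W E)"
    and A: "\<And>N. submodule N complex_ring V \<Longrightarrow> A \<subseteq> N \<Longrightarrow> N = carrier V" "A \<subseteq> carrier V"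
    and B: "\<And>N. submodule N complex_ring W \<Longrightarrow> B \<subseteq> N \<Longrightarrow> N = carrier W" "B \<subseteq> carrier W"
    and pure: "\<And>v w. v \<in> A \<Longrightarrow> w \<in> B \<Longrightarrow> pure_tensor v w \<in> Q"
  shows "Q = carrier (tensor_module V W E)"
proof -
  have Q': "\<zero>\<^bsub>tensor_module V W E\<^esub> \<in> Q" "\<And>x y. x \<in> Q \<Longrightarrow> y \<in> Q \<Longrightarrow> x \<oplus>\<^bsub>tensor_module V W E\<^esub> y \<in> Q"
    "\<And>c x. x \<in> Q \<Longrightarrow> c \<odot>\<^bsub>tensor_module V W E\<^esub> x \<in> Q"
    using Q by (auto simp: submodule_iff[OF module_tensor_module])
  have *: "{w \<in> carrier W. pure_tensor v w \<in> Q} = carrier W" if v: "v \<in> A" for v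
  proof (rule B(1))
    have "v \<in> carrier V" using v A(2) by auto
    then show "submodule {w \<in> carrier W. pure_tensor v w \<in> Q} complex_ring W"
      using Q' W.smult_closed
      by (simp add: submodule_iff[OF W.module_axioms] pure_tensor_zero_right pure_tensor_add_right pure_tensor_smult_right)
  qed (use v pure B in auto)
  have "{v \<in> carrier V. pure_tensor v w \<in> Q} = carrier V" if w: "w \<in> carrier W" for w
  proof (rule A(1))
    show "submodule {v \<in> carrier V. pure_tensor v w \<in> Q} complex_ring V"
      using Q' w V.smult_closed
      by (simp add: submodule_iff[OF V.module_axioms] pure_tensor_zero_left pure_tensor_add_left pure_tensor_smult_left)
  qed (use w * A in auto)
  then show ?thesis using tensor_submodule_eq[OF Q] by blast
qed

section \<open>Diagonal actions on tensor products\<close>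

abbreviation pair_map :: "('v \<Rightarrow> 'v) \<Rightarrow> ('w \<Rightarrow> 'w) \<Rightarrow> ('v \<times> 'w \<Rightarrow>\<^sub>0 complex) \<Rightarrow> 'v \<times> 'w \<Rightarrow>\<^sub>0 complex"
  where "pair_map f g \<equiv> linear_extension (\<lambda>(v, w). Poly_Mapping.single (f v, g w) 1)"

context
  fixes f :: "'v \<Rightarrow> 'v" and g :: "'w \<Rightarrow> 'w"
  assumes f: "linear_endo V f" and g: "linear_endo W g"
begin

lemma pair_map_closed: "u \<in> carrier F \<Longrightarrow> pair_map f g u \<in> carrier F"
  using f g unfolding free_module_simps linear_endo_def
  by (elim linear_extension_closed) (clarsimp split del: if_split simp del: keys_single intro!: keys_single_closed)

text \<open>The vectors sent into \<open>K\<close> form a submodule, so testing the generating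
  relations is enough. Linear endomorphisms carry each bilinear relation to another one; for the
  extra relations \<open>E\<close> this has to be assumed.\<close>

lemma pair_map_kernel:
  assumes E: "\<And>r. r \<in> E \<Longrightarrow> pair_map f g r \<in> K" and u: "u \<in> K"
  shows "pair_map f g u \<in> K"
proof -
  have K': "0 \<in> K" "\<And>x y. x \<in> K \<Longrightarrow> y \<in> K \<Longrightarrow> x + y \<in> K"
    "\<And>c x. x \<in> K \<Longrightarrow> Poly_Mapping.map ((*) c) x \<in> K"
    using kernel_submodule by (auto simp: submodule_iff[OF module_free_module])
  have "submodule {u \<in> carrier F. pair_map f g u \<in> K} complex_ring F"
    unfolding submodule_iff[OF module_free_module]
  proof (intro conjI ballI allI)
    show "\<zero>\<^bsub>F\<^esub> \<in> {u \<in> carrier F. pair_map f g u \<in> K}"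
      using K'(1) by (simp add: linear_extension_def)
  next
    fix x y assume "x \<in> {u \<in> carrier F. pair_map f g u \<in> K}" "y \<in> {u \<in> carrier F. pair_map f g u \<in> K}"
    then show "x \<oplus>\<^bsub>F\<^esub> y \<in> {u \<in> carrier F. pair_map f g u \<in> K}"
      using K'(2) quot.M.a_closed[of x y] by (simp add: linear_extension_add)
  next
    fix c x assume "x \<in> {u \<in> carrier F. pair_map f g u \<in> K}"
    then show "c \<odot>\<^bsub>F\<^esub> x \<in> {u \<in> carrier F. pair_map f g u \<in> K}"
      using K'(3) quot.smult_closed[of c x] by (simp add: linear_extension_scale)
  qed auto
  moreover have "bilinear_relations V W \<subseteq> {u \<in> carrier F. pair_map f g u \<in> K}"
  proof
    fix r assume r: "r \<in> bilinear_relations V W"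
    then have "pair_map f g r \<in> bilinear_relations V W"
      using f g
      by (cases rule: bilinear_relations_cases)
        (simp_all add: linear_extension_minus scale_single linear_endo_def bilinear_relationsI)
    then show "r \<in> {u \<in> carrier F. pair_map f g u \<in> K}"
      using r bilinear_relations_closed relation_in_kernel by blast
  qed
  moreover have "E \<subseteq> {u \<in> carrier F. pair_map f g u \<in> K}"
    using E relations_closed by blast
  ultimately show ?thesis using u kernel_subset_submodule by blast
qed

lemma tensor_map_coset:
  assumes E: "\<And>r. r \<in> E \<Longrightarrow> pair_map f g r \<in> K" and u: "u \<in> carrier F"
  shows "tensor_map V W E f g (K +>\<^bsub>F\<^esub> u) = K +>\<^bsub>F\<^esub> pair_map f g u"
  unfolding tensor_map_def using pair_map_closed pair_map_kernel[OF E] u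
  by (intro quot.coset_map) (auto simp: linear_extension_add)

lemma tensor_map_pure:
  assumes "\<And>r. r \<in> E \<Longrightarrow> pair_map f g r \<in> K" and "v \<in> carrier V" "w \<in> carrier W"
  shows "tensor_map V W E f g (pure_tensor v w) = pure_tensor (f v) (g w)"
  using tensor_map_coset[OF assms(1) single_in_F, of v w 1] assms
  by (simp add: pure_tensor_def scale_single)

end

end

text \<open>By \<open>inv\<close> the kernel is respected, so each module law can be checked on
  representatives; there the action is a linear extension, and the laws for products and the unit
  are compared on single pairs.\<close>

lemma monoid_module_tensor:
  assumes V: "monoid_module S V a" and W: "monoid_module S W b"
    and E: "E \<subseteq> carrier (free_module (carrier V \<times> carrier W))"
    and inv: "\<And>s r. s \<in> carrier S \<Longrightarrow> r \<in> E \<Longrightarrow>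
      linear_extension (\<lambda>(v, w). Poly_Mapping.single (a s v, b s w) 1) r \<in> tensor_kernel V W E"
  shows "monoid_module S (tensor_module V W E) (\<lambda>s. tensor_map V W E (a s) (b s))"
proof -
  interpret V: monoid_module S V a by fact
  interpret W: monoid_module S W b by fact
  interpret tensor_product V W E
    using E by unfold_locales
  note endo = V.linear_endo_act W.linear_endo_act
  note coset = tensor_map_coset[OF endo inv] and closed = pair_map_closed[OF endo]
  note T = tensor_module_def[of V W E]
  show ?thesis
  proof (rule monoid_module.intro, rule V.S.monoid_axioms, rule module_tensor_module,
      rule monoid_module_axioms.intro)
    fix s C assume s: "s \<in> carrier S" and "C \<in> carrier (tensor_module V W E)"
    then obtain u where u: "u \<in> carrier F" "C = K +>\<^bsub>F\<^esub> u" by (auto simp: T quot.quotient_carrier)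
    with s show "tensor_map V W E (a s) (b s) C \<in> carrier (tensor_module V W E)"
      using quot.quotient_in_carrier[OF closed] by (simp only: T coset)
    show "tensor_map V W E (a s) (b s) (c \<odot>\<^bsub>tensor_module V W E\<^esub> C) =
      c \<odot>\<^bsub>tensor_module V W E\<^esub> tensor_map V W E (a s) (b s) C" for c
      using u s quot.smult_closed[of c u] closed[OF s s u(1)]
      by (simp only: T coset quot.quotient_smult complex_ring_simps UNIV_I)
        (simp add: linear_extension_scale)
    show "tensor_map V W E (a s) (b s) (C \<oplus>\<^bsub>tensor_module V W E\<^esub> D) =
      tensor_map V W E (a s) (b s) C \<oplus>\<^bsub>tensor_module V W E\<^esub> tensor_map V W E (a s) (b s) D"
      if D: "D \<in> carrier (tensor_module V W E)" for D
    proof -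
      obtain u' where u': "u' \<in> carrier F" "D = K +>\<^bsub>F\<^esub> u'" using D by (auto simp: T quot.quotient_carrier)
      then show ?thesis
        using u s quot.M.a_closed[of u u'] closed[OF s s]
        by (simp only: T coset quot.quotient_add) (simp add: linear_extension_add)
    qed
    show "tensor_map V W E (a (s \<otimes>\<^bsub>S\<^esub> t)) (b (s \<otimes>\<^bsub>S\<^esub> t)) C =
      tensor_map V W E (a s) (b s) (tensor_map V W E (a t) (b t) C)" if t: "t \<in> carrier S" for t
    proof -
      have "pair_map (a (s \<otimes>\<^bsub>S\<^esub> t)) (b (s \<otimes>\<^bsub>S\<^esub> t)) u = pair_map (a s) (b s) (pair_map (a t) (b t) u)"
        unfolding linear_extension_comp using u(1) s t
        by (intro linear_extension_cong) (auto simp: V.act_mult W.act_mult scale_single subset_iff)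
      then show ?thesis
        using u s t closed[OF t t] by (simp only: coset V.S.m_closed)
    qed
  next
    fix C assume "C \<in> carrier (tensor_module V W E)"
    then obtain u where u: "u \<in> carrier F" "C = K +>\<^bsub>F\<^esub> u" by (auto simp: T quot.quotient_carrier)
    have "pair_map (a \<one>\<^bsub>S\<^esub>) (b \<one>\<^bsub>S\<^esub>) u = linear_extension (\<lambda>p. Poly_Mapping.single p 1) u"
      using u(1) by (intro linear_extension_cong) (auto simp: V.act_one W.act_one subset_iff)
    then show "tensor_map V W E (a \<one>\<^bsub>S\<^esub>) (b \<one>\<^bsub>S\<^esub>) C = C"
      using u by (simp only: coset V.S.one_closed linear_extension_basis)
  qed
qed

text \<open>Lets a monoid act on the first factor alone: with this action on \<open>U\<close>, the
  action on L(H, X) becomes a diagonal one and \<open>monoid_module_tensor\<close> covers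
  it.\<close>

lemma monoid_module_trivial:
  assumes "monoid S" "module complex_ring W"
  shows "monoid_module S W (\<lambda>_. id)"
  using assms by (intro monoid_module.intro monoid_module_axioms.intro) auto

section \<open>Orthogonal complements\<close>

text \<open>All finitely supported functions form a vector space, with each
  \<open>free_module B\<close> as a subspace. This gives access to span, independence and
  dimension.\<close>

interpretation poly_mapping_vs: vector_space "\<lambda>c::complex. Poly_Mapping.map ((*) c)"
  by unfold_locales (simp_all add: scale_add add_scale scale_scale scale_one)

definition coeff_inner :: "'b set \<Rightarrow> ('b \<Rightarrow>\<^sub>0 complex) \<Rightarrow> ('b \<Rightarrow>\<^sub>0 complex) \<Rightarrow> complex"
  where "coeff_inner B f g = (\<Sum>b\<in>B. Poly_Mapping.lookup f b * cnj (Poly_Mapping.lookup g b))"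

lemma coeff_inner_left:
  "coeff_inner B 0 h = 0"
  "coeff_inner B (f + g) h = coeff_inner B f h + coeff_inner B g h"
  "coeff_inner B (f - g) h = coeff_inner B f h - coeff_inner B g h"
  "coeff_inner B (Poly_Mapping.map ((*) c) f) h = c * coeff_inner B f h"
  by (simp_all add: coeff_inner_def lookup_add lookup_minus algebra_simps sum.distrib sum_subtractf sum_distrib_left)

lemma coeff_inner_right:
  "coeff_inner B h 0 = 0"
  "coeff_inner B h (f + g) = coeff_inner B h f + coeff_inner B h g"
  "coeff_inner B h (Poly_Mapping.map ((*) c) f) = cnj c * coeff_inner B h f"
  by (simp_all add: coeff_inner_def lookup_add algebra_simps sum.distrib sum_distrib_left)

text \<open>Conjugation in the second argument makes the product of \<open>f\<close> with itself a
  sum of squared norms; the bound on the support extends vanishing on \<open>B\<close> to vanishing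
  everywhere.\<close>

lemma coeff_inner_self_eq_0:
  assumes "finite B" "Poly_Mapping.keys f \<subseteq> B" "coeff_inner B f f = 0"
  shows "f = 0"
proof -
  have "coeff_inner B f f = of_real (\<Sum>b\<in>B. (norm (Poly_Mapping.lookup f b))\<^sup>2)"
    by (simp add: coeff_inner_def complex_norm_square[symmetric] del: of_real_power)
  then have "(\<Sum>b\<in>B. (norm (Poly_Mapping.lookup f b))\<^sup>2) = 0" using assms(3) of_real_eq_0_iff by metis
  then have "\<forall>b\<in>B. Poly_Mapping.lookup f b = 0"
    using assms(1) by (simp add: sum_nonneg_eq_0_iff)
  then have "Poly_Mapping.lookup f b = 0" for b
    using assms(2) by (cases "b \<in> B") (auto simp: in_keys_iff)
  then show ?thesis by (intro poly_mapping_eqI) simp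
qed

text \<open>Gram-Schmidt, one spanning vector at a time: \<open>e\<close> is the part of the new
  vector \<open>a\<close> orthogonal to the old span, and \<open>u'\<close> adds the component along
  \<open>e\<close> to the old projection.\<close>

lemma orthogonal_projection_span:
  assumes "finite B" "finite A" "A \<subseteq> carrier (free_module B)" "w \<in> carrier (free_module B)"
  shows "\<exists>u\<in>poly_mapping_vs.span A. \<forall>a\<in>poly_mapping_vs.span A. coeff_inner B (w - u) a = 0"
  using assms(2,3,4)
proof (induction A arbitrary: w rule: finite_induct)
  case empty
  then show ?case by (auto simp: coeff_inner_right)
next
  case (insert a A)
  note span = poly_mapping_vs.span_mono[OF subset_insertI]
  obtain a0 where a0: "a0 \<in> poly_mapping_vs.span A" "\<And>x. x \<in> poly_mapping_vs.span A \<Longrightarrow> coeff_inner B (a - a0) x = 0"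
    using insert.IH[of a] insert.prems by auto
  obtain u where u: "u \<in> poly_mapping_vs.span A" "\<And>x. x \<in> poly_mapping_vs.span A \<Longrightarrow> coeff_inner B (w - u) x = 0"
    using insert.IH[of w] insert.prems by auto
  define e where "e = a - a0"
  \<comment> \<open>If \<open>e\<close> is 0, because \<open>a\<close> lies in the old span, the
    coefficient is 0 / 0 = 0 and the old projection remains correct.\<close>
  define u' where "u' = u + Poly_Mapping.map ((*) (coeff_inner B (w - u) e / coeff_inner B e e)) e"
  have span_closed: "poly_mapping_vs.span A \<subseteq> carrier (free_module B)"
  proof (rule poly_mapping_vs.span_minimal)
    show "poly_mapping_vs.subspace (carrier (free_module B))"
      using module.carrier_is_submodule[OF module_free_module, of B]
      by (simp add: submodule_iff[OF module_free_module] poly_mapping_vs.subspace_def)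
  qed (use insert.prems in auto)
  have e_closed: "Poly_Mapping.keys e \<subseteq> B"
    unfolding e_def using subsetD[OF span_closed a0(1)] insert.prems by (intro keys_diff_closed) simp_all
  have "e \<in> poly_mapping_vs.span (insert a A)"
    unfolding e_def
    by (intro poly_mapping_vs.span_diff subsetD[OF span a0(1)] poly_mapping_vs.span_base insertI1)
  then have u': "u' \<in> poly_mapping_vs.span (insert a A)"
    unfolding u'_def
    by (intro poly_mapping_vs.span_add poly_mapping_vs.span_scale subsetD[OF span u(1)])
  have A: "coeff_inner B (w - u') x = 0" if "x \<in> poly_mapping_vs.span A" for x
    using u(2)[OF that] a0(2)[OF that] by (simp add: u'_def coeff_inner_left e_def)
  have "coeff_inner B (w - u') e = 0"
    using coeff_inner_self_eq_0[OF assms(1) e_closed]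
    by (cases "coeff_inner B e e = 0") (simp_all add: u'_def coeff_inner_left coeff_inner_right)
  then have a: "coeff_inner B (w - u') a = 0"
    using A[OF a0(1)] coeff_inner_right(2)[of B "w - u'" e a0] by (simp add: e_def)
  have "coeff_inner B (w - u') x = 0" if "x \<in> poly_mapping_vs.span (insert a A)" for x
  proof -
    obtain k where k: "x - Poly_Mapping.map ((*) k) a \<in> poly_mapping_vs.span A"
      using \<open>x \<in> _\<close> by (auto simp: poly_mapping_vs.span_insert)
    have "coeff_inner B (w - u') (x - Poly_Mapping.map ((*) k) a + Poly_Mapping.map ((*) k) a) = 0"
      unfolding coeff_inner_right A[OF k] a by simp
    then show ?thesis by simp
  qed
  with u' show ?case by blast
qed

text \<open>The unit vectors indexed by \<open>B\<close> span \<open>free_module B\<close>, so the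
  exchange lemma bounds \<open>A\<close>. Finiteness has to come from \<open>B\<close>, as the
  ambient type may be infinite-dimensional.\<close>

lemma finite_independent_in_free_module:
  assumes "finite B" "poly_mapping_vs.independent A" "A \<subseteq> carrier (free_module B)"
  shows "finite A"
proof -
  have "linear_extension (\<lambda>b. Poly_Mapping.single b 1) f \<in> poly_mapping_vs.span ((\<lambda>b. Poly_Mapping.single b 1) ` B)"
    if "f \<in> A" for f
  proof -
    have "Poly_Mapping.keys f \<subseteq> B" using subsetD[OF assms(3) that] by simp
    then show ?thesis
      unfolding linear_extension_def
      by (intro poly_mapping_vs.span_sum poly_mapping_vs.span_scale poly_mapping_vs.span_base) auto
  qed
  then have "A \<subseteq> poly_mapping_vs.span ((\<lambda>b. Poly_Mapping.single b 1) ` B)" by auto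
  then show ?thesis
    using poly_mapping_vs.independent_span_bound assms by blast
qed

lemma orthogonal_projection:
  assumes "finite B" "poly_mapping_vs.subspace N" "N \<subseteq> carrier (free_module B)" "w \<in> carrier (free_module B)"
  obtains u where "u \<in> N" "\<And>a. a \<in> N \<Longrightarrow> coeff_inner B (w - u) a = 0"
proof -
  obtain A where A: "A \<subseteq> N" "poly_mapping_vs.independent A" "N \<subseteq> poly_mapping_vs.span A"
    by (rule poly_mapping_vs.basis_exists[of N])
  have "poly_mapping_vs.span A = N"
    using poly_mapping_vs.span_minimal[OF A(1) assms(2)] A(3) by (rule subset_antisym)
  moreover have closed: "A \<subseteq> carrier (free_module B)"
    using A(1) assms(3) by (rule subset_trans)
  ultimately show thesis
    using orthogonal_projection_span[OF assms(1) finite_independent_in_free_module[OF assms(1) A(2) closed] closed assms(4)]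
      that by auto
qed

text \<open>The measure of the later induction decreases: a basis of \<open>N'\<close> together with
  a vector of \<open>N\<close> outside \<open>N'\<close> is independent, hence no larger than a
  basis of \<open>N\<close>.\<close>

lemma dim_less:
  assumes "finite B" "N \<subseteq> carrier (free_module B)" "poly_mapping_vs.subspace N'" "N' \<subset> N"
  shows "poly_mapping_vs.dim N' < poly_mapping_vs.dim N"
proof -
  obtain A' where A': "A' \<subseteq> N'" "poly_mapping_vs.independent A'" "N' \<subseteq> poly_mapping_vs.span A'" "card A' = poly_mapping_vs.dim N'"
    by (rule poly_mapping_vs.basis_exists[of N'])
  obtain A where A: "A \<subseteq> N" "poly_mapping_vs.independent A" "N \<subseteq> poly_mapping_vs.span A" "card A = poly_mapping_vs.dim N"
    by (rule poly_mapping_vs.basis_exists[of N])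
  obtain x where x: "x \<in> N" "x \<notin> N'" using assms(4) by auto
  have "poly_mapping_vs.span A' \<subseteq> N'"
    using A'(1) assms(3) by (rule poly_mapping_vs.span_minimal)
  then have x': "x \<notin> poly_mapping_vs.span A'" using x by auto
  then have "poly_mapping_vs.independent (insert x A')"
    using A'(2) by (rule poly_mapping_vs.independent_insertI)
  moreover have "insert x A' \<subseteq> poly_mapping_vs.span A"
    using A(3) A'(1) x(1) assms(4) by (simp add: subset_iff psubset_eq)
  moreover have "finite A"
    by (rule finite_independent_in_free_module[OF assms(1) A(2) subset_trans[OF A(1) assms(2)]])
  ultimately have "finite (insert x A') \<and> card (insert x A') \<le> card A"
    by (intro poly_mapping_vs.independent_span_bound)
  moreover have "x \<notin> A'" using x' poly_mapping_vs.span_base[of x A'] by auto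
  ultimately show ?thesis using A(4) A'(4) by auto
qed

section \<open>Partial maps of a basis and their adjoints\<close>

definition partial_map :: "'b set \<Rightarrow> ('b \<Rightarrow> 'b) \<Rightarrow> ('b \<Rightarrow>\<^sub>0 complex) \<Rightarrow> ('b \<Rightarrow>\<^sub>0 complex)"
  where "partial_map B p = linear_extension (\<lambda>b. if p b \<in> B then Poly_Mapping.single (p b) 1 else 0)"

text \<open>In the basis \<open>B\<close> both operators have matrices with entries 0 and 1. The
  hypothesis says that these are transposes of each other, and real entries are unchanged by
  conjugation.\<close>

lemma partial_map_adjoint:
  assumes "finite B" "\<And>b c. b \<in> B \<Longrightarrow> c \<in> B \<Longrightarrow> p b = c \<longleftrightarrow> q c = b"
    and "f \<in> carrier (free_module B)" "g \<in> carrier (free_module B)"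
  shows "coeff_inner B (partial_map B p f) g = coeff_inner B f (partial_map B q g)"
proof -
  have lookup: "Poly_Mapping.lookup (partial_map B r h) c = (\<Sum>b\<in>B. Poly_Mapping.lookup h b * (if r b = c then 1 else 0))"
    if "Poly_Mapping.keys h \<subseteq> B" "c \<in> B" for r h c
    unfolding partial_map_def linear_extension_superset[OF assms(1) that(1)] lookup_sum lookup_scale
    using that(2) by (intro sum.cong) (auto simp: lookup_single when_def)
  have "coeff_inner B (partial_map B p f) g =
    (\<Sum>c\<in>B. \<Sum>b\<in>B. Poly_Mapping.lookup f b * (if p b = c then 1 else 0) * cnj (Poly_Mapping.lookup g c))"
    using assms(3) by (simp add: coeff_inner_def lookup sum_distrib_right)
  also have "\<dots> = (\<Sum>b\<in>B. \<Sum>c\<in>B. Poly_Mapping.lookup f b * (if p b = c then 1 else 0) * cnj (Poly_Mapping.lookup g c))"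
    by (rule sum.swap)
  also have "\<dots> = (\<Sum>b\<in>B. \<Sum>c\<in>B. Poly_Mapping.lookup f b * cnj (Poly_Mapping.lookup g c * (if q c = b then 1 else 0)))"
    using assms(2) by (intro sum.cong refl) simp
  also have "\<dots> = coeff_inner B f (partial_map B q g)"
    using assms(4) by (simp add: coeff_inner_def lookup sum_distrib_left)
  finally show ?thesis .
qed

lemma partial_map_closed: "f \<in> carrier (free_module B) \<Longrightarrow> partial_map B p f \<in> carrier (free_module B)"
  unfolding partial_map_def free_module_simps by (erule linear_extension_closed) auto

section \<open>Homomorphic images of free modules\<close>

context monoid_module
begin

text \<open>Counterpart of \<open>linear_extension\<close> with values in an arbitrary module record
  instead of a free module.\<close>

definition realization :: "'b set \<Rightarrow> ('b \<Rightarrow> 'v) \<Rightarrow> ('b \<Rightarrow>\<^sub>0 complex) \<Rightarrow> 'v"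
  where "realization B \<theta> f = (\<Oplus>\<^bsub>V\<^esub>b\<in>B. Poly_Mapping.lookup f b \<odot>\<^bsub>V\<^esub> \<theta> b)"

text \<open>The vectors \<open>\<theta> b\<close> are moved or killed as the partial maps
  \<open>\<sigma> s\<close> prescribe. They may coincide or be linearly dependent, so the
  homomorphism \<open>\<Theta>\<close> can have a kernel.\<close>

context
  fixes B :: "'b set" and \<theta> :: "'b \<Rightarrow> 'v" and \<sigma> :: "'s \<Rightarrow> 'b \<Rightarrow> 'b"
  assumes fin: "finite B" and \<theta>_closed: "\<And>b. b \<in> B \<Longrightarrow> \<theta> b \<in> carrier V"
    and \<theta>_act: "\<And>s b. s \<in> carrier S \<Longrightarrow> b \<in> B \<Longrightarrow> act s (\<theta> b) = (if \<sigma> s b \<in> B then \<theta> (\<sigma> s b) else \<zero>\<^bsub>V\<^esub>)"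
begin

abbreviation "\<Theta> \<equiv> realization B \<theta>"

lemma realization_closed: "\<Theta> f \<in> carrier V"
  unfolding realization_def using \<theta>_closed by (intro V.finsum_closed) (simp add: Pi_iff)

lemma realization_add: "\<Theta> (f + g) = \<Theta> f \<oplus>\<^bsub>V\<^esub> \<Theta> g"
proof -
  have "(\<Oplus>\<^bsub>V\<^esub>b\<in>B. Poly_Mapping.lookup (f + g) b \<odot>\<^bsub>V\<^esub> \<theta> b) =
    (\<Oplus>\<^bsub>V\<^esub>b\<in>B. Poly_Mapping.lookup f b \<odot>\<^bsub>V\<^esub> \<theta> b \<oplus>\<^bsub>V\<^esub> Poly_Mapping.lookup g b \<odot>\<^bsub>V\<^esub> \<theta> b)"
    using \<theta>_closed
    by (intro V.finsum_cong') (simp_all add: lookup_add V.smult_l_distr[simplified] Pi_iff)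
  also have "\<dots> = \<Theta> f \<oplus>\<^bsub>V\<^esub> \<Theta> g"
    unfolding realization_def using \<theta>_closed by (intro V.finsum_addf) (simp_all add: Pi_iff)
  finally show ?thesis by (simp add: realization_def)
qed

lemma realization_scale: "\<Theta> (Poly_Mapping.map ((*) c) f) = c \<odot>\<^bsub>V\<^esub> \<Theta> f"
proof -
  have "(\<Oplus>\<^bsub>V\<^esub>b\<in>B. Poly_Mapping.lookup (Poly_Mapping.map ((*) c) f) b \<odot>\<^bsub>V\<^esub> \<theta> b) =
    (\<Oplus>\<^bsub>V\<^esub>b\<in>B. c \<odot>\<^bsub>V\<^esub> (Poly_Mapping.lookup f b \<odot>\<^bsub>V\<^esub> \<theta> b))"
    using \<theta>_closed by (intro V.finsum_cong') (simp_all add: V.smult_assoc1[simplified] Pi_iff)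
  also have "\<dots> = c \<odot>\<^bsub>V\<^esub> \<Theta> f"
    unfolding realization_def using \<theta>_closed fin by (intro V.finsum_smult_ldistr[symmetric]) (simp_all add: Pi_iff)
  finally show ?thesis by (simp add: realization_def)
qed

lemma realization_zero: "\<Theta> 0 = \<zero>\<^bsub>V\<^esub>"
  using realization_scale[of 0 0] V.smult_l_null[OF realization_closed, of 0] by (simp add: scale_zero)

lemma realization_single: "b \<in> B \<Longrightarrow> \<Theta> (Poly_Mapping.single b 1) = \<theta> b"
proof -
  assume b: "b \<in> B"
  have "\<Theta> (Poly_Mapping.single b 1) = (\<Oplus>\<^bsub>V\<^esub>c\<in>B. if b = c then \<theta> c else \<zero>\<^bsub>V\<^esub>)"
    unfolding realization_def using \<theta>_closed
    by (intro V.finsum_cong') (simp_all add: lookup_single when_def V.smult_l_null[simplified] Pi_iff)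
  also have "\<dots> = \<theta> b"
    using b fin \<theta>_closed by (intro V.finsum_singleton) (simp_all add: Pi_iff)
  finally show ?thesis .
qed

text \<open>Both sides are linear in \<open>f\<close>, and on basis vectors the equation is the
  assumption on \<open>\<theta>\<close>.\<close>

lemma realization_act:
  assumes s: "s \<in> carrier S" and f: "f \<in> carrier (free_module B)"
  shows "\<Theta> (partial_map B (\<sigma> s) f) = act s (\<Theta> f)"
proof -
  let ?N = "{f \<in> carrier (free_module B). \<Theta> (partial_map B (\<sigma> s) f) = act s (\<Theta> f)}"
  have "?N = carrier (free_module B)"
  proof (rule free_module_submodule_eq)
    have "partial_map B (\<sigma> s) 0 = 0" by (simp add: partial_map_def linear_extension_def)
    then show "submodule ?N complex_ring (free_module B)"
      using module.carrier_is_submodule[OF module_free_module, of B] s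
      unfolding submodule_iff[OF module_free_module]
      by (auto simp: partial_map_def linear_extension_add linear_extension_scale realization_add
          realization_scale act_add act_smult realization_closed realization_zero act_zero
          simp del: free_module_simps(1))
    show "Poly_Mapping.single b 1 \<in> ?N" if "b \<in> B" for b
      using that s by (simp add: partial_map_def scale_one realization_single realization_zero \<theta>_act)
  qed
  with f show ?thesis by blast
qed

text \<open>Kept apart from \<open>invariant_submodule\<close> and phrased in the vector space
  language, where dimension is available for the induction.\<close>

definition invariant_subspace :: "('b \<Rightarrow>\<^sub>0 complex) set \<Rightarrow> bool"
  where "invariant_subspace N \<longleftrightarrow> poly_mapping_vs.subspace N \<and> N \<subseteq> carrier (free_module B) \<and>
    (\<forall>s\<in>carrier S. \<forall>f\<in>N. partial_map B (\<sigma> s) f \<in> N)"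

lemma realization_image_invariant:
  assumes "invariant_subspace N"
  shows "invariant_submodule S V act (\<Theta> ` N)"
  unfolding invariant_submodule_iff
proof (intro conjI ballI allI)
  have N: "0 \<in> N" "\<And>f g. f \<in> N \<Longrightarrow> g \<in> N \<Longrightarrow> f + g \<in> N"
    "\<And>c f. f \<in> N \<Longrightarrow> Poly_Mapping.map ((*) c) f \<in> N"
    using assms by (simp_all add: invariant_subspace_def poly_mapping_vs.subspace_def)
  show "\<Theta> ` N \<subseteq> carrier V" using realization_closed by auto
  show "\<zero>\<^bsub>V\<^esub> \<in> \<Theta> ` N"
    unfolding realization_zero[symmetric] using N(1) by (rule imageI)
  show "v \<oplus>\<^bsub>V\<^esub> w \<in> \<Theta> ` N" if vw: "v \<in> \<Theta> ` N" "w \<in> \<Theta> ` N" for v w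
  proof -
    obtain f g where "f \<in> N" "g \<in> N" "v = \<Theta> f" "w = \<Theta> g" using vw by auto
    then show ?thesis using imageI[OF N(2), of f g \<Theta>] by (simp add: realization_add)
  qed
  show "c \<odot>\<^bsub>V\<^esub> v \<in> \<Theta> ` N" if v: "v \<in> \<Theta> ` N" for c v
  proof -
    obtain f where "f \<in> N" "v = \<Theta> f" using v by auto
    then show ?thesis using imageI[OF N(3), of f \<Theta> c] by (simp add: realization_scale)
  qed
  show "act s v \<in> \<Theta> ` N" if s: "s \<in> carrier S" and "v \<in> \<Theta> ` N" for s v
  proof -
    obtain f where f: "f \<in> N" "v = \<Theta> f" using \<open>v \<in> _\<close> by auto
    then have "act s v = \<Theta> (partial_map B (\<sigma> s) f)"
      using realization_act[OF s, of f] assms by (auto simp: invariant_subspace_def)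
    then show ?thesis using f s assms by (auto simp: invariant_subspace_def)
  qed
qed

lemma realization_preimage_invariant:
  assumes N: "invariant_subspace N" and Q: "invariant_submodule S V act Q"
  shows "invariant_subspace {f \<in> N. \<Theta> f \<in> Q}"
proof -
  have "\<Theta> (partial_map B (\<sigma> s) f) = act s (\<Theta> f)" if "s \<in> carrier S" "f \<in> N" for s f
    using that N by (intro realization_act) (auto simp: invariant_subspace_def simp del: free_module_simps)
  then show ?thesis
    using assms unfolding invariant_subspace_def poly_mapping_vs.subspace_def invariant_submodule_iff
    by (simp add: realization_zero realization_add realization_scale) blast
qed

text \<open>Induction on the dimension of \<open>N\<close>. A proper non-zero invariant
  \<open>N1\<close> splits off with its orthogonal complement, and both have smaller dimension. If
  there is none, the image of \<open>N\<close> is zero or simple, as in Schur's lemma.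
  \<open>T\<close> plays the part of the sum of all simple submodules.\<close>

lemma realization_subset_sum_of_simples:
  assumes adj: "\<And>s. s \<in> carrier S \<Longrightarrow> \<exists>t\<in>carrier S. \<forall>b\<in>B. \<forall>c\<in>B. \<sigma> s b = c \<longleftrightarrow> \<sigma> t c = b"
    and T: "invariant_submodule S V act T" "\<And>W. simple_submodule S V act W \<Longrightarrow> W \<subseteq> T"
    and N: "invariant_subspace N"
  shows "\<Theta> ` N \<subseteq> T"
  using N
proof (induction "poly_mapping_vs.dim N" arbitrary: N rule: less_induct)
  case less
  note N = less.prems[unfolded invariant_subspace_def]
  show ?case
  proof (cases "\<exists>N1. invariant_subspace N1 \<and> N1 \<subset> N \<and> N1 \<noteq> {0}")
    case True
    then obtain N1 where N1: "invariant_subspace N1" "N1 \<subset> N" "N1 \<noteq> {0}" by auto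
    note N1' = N1(1)[unfolded invariant_subspace_def]
    define N2 where "N2 = {f \<in> N. \<forall>g\<in>N1. coeff_inner B f g = 0}"
    have "invariant_subspace N2"
      unfolding invariant_subspace_def
    proof (intro conjI ballI)
      show "poly_mapping_vs.subspace N2"
        using N unfolding N2_def poly_mapping_vs.subspace_def by (auto simp: coeff_inner_left)
      show "N2 \<subseteq> carrier (free_module B)" using N by (auto simp: N2_def)
      fix s f assume s: "s \<in> carrier S" and f: "f \<in> N2"
      obtain t where t: "t \<in> carrier S" "\<And>b c. b \<in> B \<Longrightarrow> c \<in> B \<Longrightarrow> \<sigma> s b = c \<longleftrightarrow> \<sigma> t c = b"
        using adj[OF s] by blast
      \<comment> \<open>The operator of \<open>s\<close> passes to the other side as that of
        \<open>t\<close>, under which \<open>N1\<close> is invariant; hence the complement is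
        invariant under \<open>s\<close>.\<close>
      have "coeff_inner B (partial_map B (\<sigma> s) f) g = coeff_inner B f (partial_map B (\<sigma> t) g)" if "g \<in> N1" for g
        using that f N N1' by (intro partial_map_adjoint fin t(2)) (auto simp: N2_def simp del: free_module_simps)
      then show "partial_map B (\<sigma> s) f \<in> N2"
        using f s t(1) N N1' by (auto simp: N2_def)
    qed
    moreover have "N2 \<subset> N"
    proof -
      obtain g where g: "g \<in> N1" "g \<noteq> 0"
        using N1' N1(3) by (auto simp: poly_mapping_vs.subspace_def)
      \<comment> \<open>A non-zero vector is not orthogonal to itself, so the complement is a proper
        subspace.\<close>
      then have "g \<notin> N2"
        using coeff_inner_self_eq_0[OF fin, of g] subsetD[of N1 "carrier (free_module B)" g] N1'
        by (auto simp: N2_def)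
      then show ?thesis using g N1(2) by (auto simp: N2_def)
    qed
    moreover have dims: "poly_mapping_vs.dim N1 < poly_mapping_vs.dim N" "poly_mapping_vs.dim N2 < poly_mapping_vs.dim N"
      using dim_less[OF fin _ _ N1(2)] dim_less[OF fin _ _ \<open>N2 \<subset> N\<close>] N N1' \<open>invariant_subspace N2\<close>
      by (simp_all add: invariant_subspace_def)
    ultimately have sub: "\<Theta> ` N1 \<subseteq> T" "\<Theta> ` N2 \<subseteq> T"
      by (simp_all only: less.hyps N1(1))
    show ?thesis
    proof
      fix v assume "v \<in> \<Theta> ` N"
      then obtain f where f: "f \<in> N" "v = \<Theta> f" by auto
      \<comment> \<open>Projecting \<open>f\<close> to \<open>N1\<close> shows that \<open>N\<close>
        is the sum of \<open>N1\<close> and \<open>N2\<close>.\<close>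
      obtain u where u: "u \<in> N1" "\<And>a. a \<in> N1 \<Longrightarrow> coeff_inner B (f - u) a = 0"
        using orthogonal_projection[OF fin, of N1 f] N1' subsetD[of N "carrier (free_module B)" f] N f
        by (auto simp del: free_module_simps)
      have "f - u \<in> N2"
        using f u N1(2) N poly_mapping_vs.subspace_diff[of N f u] by (auto simp: N2_def psubset_eq)
      then have "\<Theta> (u + (f - u)) \<in> T"
        unfolding realization_add using u(1) sub T(1)[unfolded invariant_submodule_iff] by (simp add: image_subset_iff)
      then show "v \<in> T" using f by simp
    qed
  next
    case False
    then have triv: "N' = {0} \<or> N' = N" if "invariant_subspace N'" "N' \<subseteq> N" for N'
      using that by auto
    show ?thesis
    \<comment> \<open>The question is whether \<open>\<Theta>\<close> kills all of \<open>N\<close>;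
      the case \<open>N = {0}\<close> falls under a positive answer, so it cannot reach the proof of
      simplicity.\<close>
    proof (cases "{f \<in> N. \<Theta> f \<in> {\<zero>\<^bsub>V\<^esub>}} = N")
      case True
      then have "\<Theta> f = \<zero>\<^bsub>V\<^esub>" if "f \<in> N" for f using that by blast
      then show ?thesis using T(1) by (auto simp: invariant_submodule_iff)
    next
      case False
      have "simple_submodule S V act (\<Theta> ` N)"
        unfolding simple_submodule_iff[OF monoid_module_axioms]
      proof (intro conjI allI impI)
        show "invariant_submodule S V act (\<Theta> ` N)" by (rule realization_image_invariant[OF less.prems])
        show "\<Theta> ` N \<noteq> {\<zero>\<^bsub>V\<^esub>}" using False by auto
        fix Q assume Q: "invariant_submodule S V act Q \<and> Q \<subseteq> \<Theta> ` N"
        \<comment> \<open>\<open>Q\<close> lies inside the image, so it is the image of its preimage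
          \<open>P\<close>; as an invariant subspace of \<open>N\<close>, this preimage is 0 or
          \<open>N\<close>.\<close>
        define P where "P = {f \<in> N. \<Theta> f \<in> Q}"
        have "Q = \<Theta> ` P" using Q by (auto simp: P_def)
        moreover have "P = {0} \<or> P = N"
          unfolding P_def using Q by (intro triv realization_preimage_invariant less.prems) auto
        ultimately show "Q = {\<zero>\<^bsub>V\<^esub>} \<or> Q = \<Theta> ` N"
          by (elim disjE) (simp_all add: realization_zero)
      qed
      then show ?thesis by (rule T(2))
    qed
  qed
qed

lemma realization_basis_in_sum_of_simples:
  assumes "\<And>s. s \<in> carrier S \<Longrightarrow> \<exists>t\<in>carrier S. \<forall>b\<in>B. \<forall>c\<in>B. \<sigma> s b = c \<longleftrightarrow> \<sigma> t c = b"
    and "invariant_submodule S V act T" "\<And>W. simple_submodule S V act W \<Longrightarrow> W \<subseteq> T" and b: "b \<in> B"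
  shows "\<theta> b \<in> T"
proof -
  have "invariant_subspace (carrier (free_module B))"
    using partial_map_closed[of _ B] module.carrier_is_submodule[OF module_free_module, of B]
    unfolding invariant_subspace_def submodule_iff[OF module_free_module] poly_mapping_vs.subspace_def
    by auto
  then have "\<Theta> ` carrier (free_module B) \<subseteq> T"
    using assms(1-3) by (intro realization_subset_sum_of_simples)
  moreover have "\<Theta> (Poly_Mapping.single b 1) \<in> \<Theta> ` carrier (free_module B)"
    using b by (intro imageI) simp
  ultimately show ?thesis using realization_single[OF b] by auto
qed

end

end

section \<open>Factorpowers\<close>

definition act_image :: "('g \<Rightarrow> 'm \<Rightarrow> 'm) \<Rightarrow> 'g set \<Rightarrow> 'm \<Rightarrow> 'm set"
  where "act_image \<phi> A m = {\<phi> a m | a. a \<in> A}"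

locale finite_group_action = group_action G M \<phi> + G?: group G
  for G :: "('g, 'e) monoid_scheme" (structure) and M :: "'m set" and \<phi> :: "'g \<Rightarrow> 'm \<Rightarrow> 'm" +
  assumes finite_group: "finite (carrier G)"
begin

abbreviation valid :: "'g set \<Rightarrow> bool" where "valid A \<equiv> A \<subseteq> carrier G \<and> A \<noteq> {}"
abbreviation cls :: "'g set \<Rightarrow> 'g set set" where "cls \<equiv> fp_class G M \<phi>"
abbreviation FP :: "'g set set monoid" where "FP \<equiv> factorpower G M \<phi>"

lemma fp_eqv_iff:
  "(A, B) \<in> fp_eqv G M \<phi> \<longleftrightarrow> valid A \<and> valid B \<and> (\<forall>m\<in>M. act_image \<phi> A m = act_image \<phi> B m)"
  by (auto simp: fp_eqv_def act_image_def)

lemma equiv_fp_eqv: "equiv {A. valid A} (fp_eqv G M \<phi>)"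
proof (intro equivI refl_onI symI transI)
  show "fp_eqv G M \<phi> \<subseteq> {A. valid A} \<times> {A. valid A}" by (auto simp: fp_eqv_def)
qed (simp_all add: fp_eqv_iff)

lemma fp_class_eq_iff:
  assumes "valid A" "valid B"
  shows "cls A = cls B \<longleftrightarrow> (\<forall>m\<in>M. act_image \<phi> A m = act_image \<phi> B m)"
  using eq_equiv_class_iff[OF equiv_fp_eqv, of A B] assms
  unfolding fp_class_def fp_eqv_iff by simp

lemma in_fp_class_iff:
  assumes "valid A"
  shows "B \<in> cls A \<longleftrightarrow> valid B \<and> cls B = cls A"
proof (cases "valid B")
  case True
  then show ?thesis
    using assms unfolding fp_class_eq_iff[OF True assms] by (simp add: fp_class_def fp_eqv_iff eq_commute)
next
  case False
  then show ?thesis by (auto simp: fp_class_def fp_eqv_iff)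
qed

lemma act_image_subset: "A \<subseteq> carrier G \<Longrightarrow> m \<in> M \<Longrightarrow> act_image \<phi> A m \<subseteq> M"
  using element_image by (auto simp: act_image_def)

lemma act_image_set_mult:
  assumes "A \<subseteq> carrier G" "B \<subseteq> carrier G" "m \<in> M"
  shows "act_image \<phi> (A <#> B) m = (\<Union>x\<in>act_image \<phi> B m. act_image \<phi> A x)"
proof -
  have "\<phi> (a \<otimes> b) m = \<phi> a (\<phi> b m)" if "a \<in> A" "b \<in> B" for a b
    using that assms composition_rule by blast
  then have "act_image \<phi> (A <#> B) m = {\<phi> a (\<phi> b m) | a b. a \<in> A \<and> b \<in> B}"
    unfolding act_image_def set_mult_def by (auto; metis)
  then show ?thesis
    by (auto simp: act_image_def)
qed

lemma valid_set_mult: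
  assumes "valid A" "valid B"
  shows "valid (A <#> B)"
proof
  show "A <#> B \<subseteq> carrier G" using assms by (intro set_mult_closed) simp_all
  show "A <#> B \<noteq> {}" using assms by (auto simp: set_mult_def)
qed

text \<open>The image of m under A B is the union of the images under A of the points x in B m, so
  it depends only on pointwise images. These x lie in \<open>M\<close>, where \<open>A\<close> and
  \<open>A'\<close> can be compared.\<close>

lemma fp_class_set_mult_cong:
  assumes "valid A" "valid A'" "valid B" "valid B'" "cls A = cls A'" "cls B = cls B'"
  shows "cls (A <#> B) = cls (A' <#> B')"
  unfolding fp_class_eq_iff[OF valid_set_mult[OF assms(1,3)] valid_set_mult[OF assms(2,4)]]
proof
  fix m assume m: "m \<in> M"
  have "act_image \<phi> B m = act_image \<phi> B' m"
    using assms(6) m fp_class_eq_iff[OF assms(3,4)] by simp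
  moreover have "act_image \<phi> A x = act_image \<phi> A' x" if "x \<in> act_image \<phi> B m" for x
    using assms(5) act_image_subset[of B m] assms(3) m that fp_class_eq_iff[OF assms(1,2)] by auto
  ultimately show "act_image \<phi> (A <#> B) m = act_image \<phi> (A' <#> B') m"
    using assms m by (simp add: act_image_set_mult)
qed

lemma FP_carrier: "x \<in> carrier FP \<longleftrightarrow> (\<exists>A. valid A \<and> x = cls A)"
proof -
  have "carrier FP = {A. valid A} // fp_eqv G M \<phi>" by (simp add: factorpower_def)
  also have "\<dots> = cls ` {A. valid A}" by (auto simp: quotient_def fp_class_def)
  finally show ?thesis by (simp only: image_iff mem_Collect_eq Bex_def)
qed

lemma FP_cases:
  assumes "x \<in> carrier FP"
  obtains A where "valid A" "x = cls A"
  using assms unfolding FP_carrier by (elim exE conjE) (rule that[OF conjI])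

lemma fp_class_in_FP: "valid A \<Longrightarrow> cls A \<in> carrier FP"
  unfolding FP_carrier by (rule exI[of _ A]) simp

lemma FP_one: "\<one>\<^bsub>FP\<^esub> = cls {\<one>}"
  by (simp add: factorpower_def)

lemma FP_mult:
  assumes "valid A" "valid B"
  shows "cls A \<otimes>\<^bsub>FP\<^esub> cls B = cls (A <#> B)"
proof -
  have "A \<in> cls A" "B \<in> cls B"
    unfolding in_fp_class_iff[OF assms(1)] in_fp_class_iff[OF assms(2)] using assms by simp_all
  then have nonempty: "cls A \<noteq> {}" "cls B \<noteq> {}" by (metis empty_iff)+
  have "cls (A' <#> B') = cls (A <#> B)" if A': "A' \<in> cls A" and B': "B' \<in> cls B" for A' B'
    using A'[unfolded in_fp_class_iff[OF assms(1)]] B'[unfolded in_fp_class_iff[OF assms(2)]]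
    by (intro fp_class_set_mult_cong) (simp_all add: assms)
  \<comment> \<open>The product of classes is a union over all representatives. All its terms agree
    and both classes are non-empty, so it is a single class.\<close>
  then have "(\<Union>A'\<in>cls A. \<Union>B'\<in>cls B. cls (A' <#> B')) = (\<Union>A'\<in>cls A. \<Union>B'\<in>cls B. cls (A <#> B))"
    by (intro SUP_cong refl)
  also have "\<dots> = cls (A <#> B)" by (simp add: UN_constant nonempty)
  finally show ?thesis by (simp add: factorpower_def)
qed

lemma monoid_FP: "monoid FP"
proof
  have one: "valid {\<one>}" by simp
  show "\<one>\<^bsub>FP\<^esub> \<in> carrier FP" unfolding FP_one using one by (rule fp_class_in_FP)
  fix x assume "x \<in> carrier FP"
  then obtain A where A: "valid A" "x = cls A" by (rule FP_cases)
  have "{\<one>} <#> A = A" "A <#> {\<one>} = A" using A by (auto simp: set_mult_def subset_iff)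
  then show "\<one>\<^bsub>FP\<^esub> \<otimes>\<^bsub>FP\<^esub> x = x" "x \<otimes>\<^bsub>FP\<^esub> \<one>\<^bsub>FP\<^esub> = x"
    using FP_mult[OF one A(1)] FP_mult[OF A(1) one] by (simp_all only: A(2) FP_one)
  fix y assume "y \<in> carrier FP"
  then obtain B where B: "valid B" "y = cls B" by (rule FP_cases)
  show "x \<otimes>\<^bsub>FP\<^esub> y \<in> carrier FP"
    unfolding A(2) B(2) FP_mult[OF A(1) B(1)] by (intro fp_class_in_FP valid_set_mult A B)
  fix z assume "z \<in> carrier FP"
  then obtain C where C: "valid C" "z = cls C" by (rule FP_cases)
  show "x \<otimes>\<^bsub>FP\<^esub> y \<otimes>\<^bsub>FP\<^esub> z = x \<otimes>\<^bsub>FP\<^esub> (y \<otimes>\<^bsub>FP\<^esub> z)"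
    unfolding A(2) B(2) C(2)
    using FP_mult[OF A(1) B(1)] FP_mult[OF B(1) C(1)] FP_mult[OF valid_set_mult[OF A(1) B(1)] C(1)]
      FP_mult[OF A(1) valid_set_mult[OF B(1) C(1)]] set_mult_assoc[of A B C] A(1) B(1) C(1)
    by simp
qed

text \<open>The elements that keep every point in its \<open>H\<close>-orbit form a subgroup
  \<open>K\<close> above \<open>H\<close> with the same orbits, so \<open>K = H\<close>. Through
  this lemma alone does the maximality of \<open>H\<close>, beyond its being a subgroup, enter the
  later proofs.\<close>

lemma orbit_maximal_mem:
  assumes H: "orbit_maximal G M \<phi> H" and g: "g \<in> carrier G" "\<And>m. m \<in> M \<Longrightarrow> \<phi> g m \<in> act_image \<phi> H m"
  shows "g \<in> H"
proof -
  have sub: "subgroup H G" using H by (simp add: orbit_maximal_def)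
  interpret H: subgroup H G by fact
  define K where "K = {g \<in> carrier G. \<forall>m\<in>M. \<phi> g m \<in> act_image \<phi> H m}"
  have HK: "H \<subseteq> K" by (auto simp: K_def act_image_def)
  have trans: "act_image \<phi> H x \<subseteq> act_image \<phi> H m" if m: "m \<in> M" and "x \<in> act_image \<phi> H m" for x m
  proof -
    obtain h where h: "h \<in> H" "x = \<phi> h m" using \<open>x \<in> _\<close> by (auto simp: act_image_def)
    have "\<phi> h' x = \<phi> (h' \<otimes> h) m" if "h' \<in> H" for h'
      using that h m by (simp add: composition_rule)
    then show ?thesis using h(1) by (auto simp: act_image_def)
  qed
  have "subgroup K G"
  proof (rule subgroupI)
    show "K \<subseteq> carrier G" by (auto simp: K_def)
    show "K \<noteq> {}" using HK H.one_closed by blast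
  next
    fix a b assume ab: "a \<in> K" "b \<in> K"
    have "\<phi> (a \<otimes> b) m \<in> act_image \<phi> H m" if m: "m \<in> M" for m
    proof -
      have b: "\<phi> b m \<in> M" "\<phi> b m \<in> act_image \<phi> H m" using ab m element_image by (auto simp: K_def)
      then have "\<phi> a (\<phi> b m) \<in> act_image \<phi> H (\<phi> b m)" using ab by (auto simp: K_def)
      then show ?thesis using trans[OF m b(2)] ab m by (auto simp: K_def composition_rule)
    qed
    then show "a \<otimes> b \<in> K" using ab by (auto simp: K_def)
  next
    fix a assume a: "a \<in> K"
    \<comment> \<open>Finiteness yields the inverse: \<open>a\<close> maps the finite orbit of
      \<open>m\<close> injectively into itself, so \<open>m\<close> is the image of some point of
      that orbit.\<close>
    have "\<phi> (inv a) m \<in> act_image \<phi> H m" if m: "m \<in> M" for m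
    proof -
      let ?O = "act_image \<phi> H m"
      have O: "?O \<subseteq> M" using m H.subset by (rule act_image_subset[rotated])
      have "finite ?O" using finite_subset[OF H.subset finite_group] by (simp add: act_image_def)
      moreover have "\<phi> a ` ?O \<subseteq> ?O"
        using a O trans[OF m] by (fastforce simp: K_def)
      moreover have "inj_on (\<phi> a) ?O"
        using inj_prop[of a] a O by (auto simp: K_def intro: inj_on_subset)
      ultimately have "\<phi> a ` ?O = ?O" by (intro endo_inj_surj)
      moreover have "m \<in> ?O"
        using m id_eq_one H.one_closed by (fastforce simp: act_image_def dest: fun_cong[of _ _ m])
      ultimately obtain x where x: "x \<in> ?O" "\<phi> a x = m" by (metis imageE)
      then have "\<phi> (inv a) m = x" using a O by (intro orbit_sym_aux) (auto simp: K_def)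
      then show ?thesis using x by simp
    qed
    then show "inv a \<in> K" using a by (auto simp: K_def)
  qed
  moreover have "orbit_equivalent G M \<phi> H K"
  proof -
    have "act_image \<phi> H m = act_image \<phi> K m" if "m \<in> M" for m
      using HK that by (auto simp: act_image_def K_def)
    then show ?thesis
      unfolding orbit_equivalent_def orbits_def orbit_def act_image_def by simp (metis (no_types, lifting))
  qed
  ultimately have "K = H" using H HK by (auto simp: orbit_maximal_def)
  then show ?thesis using g by (auto simp: K_def)
qed

lemma set_mult_l_coset: "A \<subseteq> carrier G \<Longrightarrow> g \<in> carrier G \<Longrightarrow> H \<subseteq> carrier G \<Longrightarrow>
    A <#> (g <# H) = {a \<otimes> g \<otimes> h | a h. a \<in> A \<and> h \<in> H}"
  by (force simp: set_mult_def l_coset_def m_assoc subset_iff)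

end

section \<open>Left cosets of an orbit-maximal subgroup\<close>

locale orbit_maximal_subgroup = finite_group_action G M \<phi>
  for G :: "('g, 'e) monoid_scheme" (structure) and M :: "'m set" and \<phi> :: "'g \<Rightarrow> 'm \<Rightarrow> 'm" +
  fixes H :: "'g set"
  assumes orbit_maximal: "orbit_maximal G M \<phi> H"
begin

sublocale H: subgroup H G
  using orbit_maximal by (simp add: orbit_maximal_def)

lemma valid_coset:
  assumes "g \<in> carrier G"
  shows "valid (g <# H)"
proof -
  have "g \<otimes> \<one> \<in> g <# H" unfolding l_coset_def using H.one_closed by blast
  then show ?thesis using l_coset_subset_G[OF H.subset assms] by blast
qed

text \<open>From left to right, a g m lies in g' H m for every point m, so the element in question
  keeps each point in its \<open>H\<close>-orbit and maximality puts it into \<open>H\<close>. From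
  right to left, the two subsets of the group are equal, not only equivalent.\<close>

lemma coset_mult_eq_iff:
  assumes A: "valid A" and g: "g \<in> carrier G" "g' \<in> carrier G"
  shows "cls A \<otimes>\<^bsub>FP\<^esub> cls (g <# H) = cls (g' <# H) \<longleftrightarrow> (\<forall>a\<in>A. inv g' \<otimes> a \<otimes> g \<in> H)"
proof
  assume L: "cls A \<otimes>\<^bsub>FP\<^esub> cls (g <# H) = cls (g' <# H)"
  show "\<forall>a\<in>A. inv g' \<otimes> a \<otimes> g \<in> H"
  proof
    fix a assume a: "a \<in> A"
    then have aG: "a \<in> carrier G" using A by auto
    show "inv g' \<otimes> a \<otimes> g \<in> H"
    proof (rule orbit_maximal_mem[OF orbit_maximal])
      show "inv g' \<otimes> a \<otimes> g \<in> carrier G" using g aG by simp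
      fix m assume m: "m \<in> M"
      have "act_image \<phi> (A <#> (g <# H)) m = act_image \<phi> (g' <# H) m"
        using L A valid_coset[OF g(1)] valid_coset[OF g(2)] valid_set_mult m
        by (simp add: FP_mult fp_class_eq_iff)
      moreover have "a \<otimes> g \<in> A <#> (g <# H)"
      proof -
        have "a \<otimes> g = a \<otimes> g \<otimes> \<one>" using aG g by simp
        then show ?thesis using set_mult_l_coset[of A g H] A g a H.subset H.one_closed by blast
      qed
      ultimately have "\<phi> (a \<otimes> g) m \<in> act_image \<phi> (g' <# H) m"
        by (auto simp: act_image_def)
      then obtain h where h: "h \<in> H" "\<phi> (a \<otimes> g) m = \<phi> (g' \<otimes> h) m"
        by (auto simp: act_image_def l_coset_def)
      have "\<phi> (inv g' \<otimes> a \<otimes> g) m = \<phi> (inv g' \<otimes> (a \<otimes> g)) m" using aG g by (simp add: m_assoc)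
      also have "\<dots> = \<phi> (inv g') (\<phi> (g' \<otimes> h) m)"
        using aG g m h by (simp add: composition_rule[of m "inv g'" "a \<otimes> g"])
      also have "\<dots> = \<phi> (inv g' \<otimes> (g' \<otimes> h)) m"
        using g m h by (intro composition_rule[symmetric]) auto
      also have "\<dots> = \<phi> h m" using g h by (simp add: m_assoc[symmetric])
      finally show "\<phi> (inv g' \<otimes> a \<otimes> g) m \<in> act_image \<phi> H m" using h by (auto simp: act_image_def)
    qed
  qed
next
  assume R: "\<forall>a\<in>A. inv g' \<otimes> a \<otimes> g \<in> H"
  have "{a \<otimes> g \<otimes> h | a h. a \<in> A \<and> h \<in> H} = g' <# H"
  proof (intro equalityI subsetI)
    fix x assume "x \<in> {a \<otimes> g \<otimes> h | a h. a \<in> A \<and> h \<in> H}"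
    then obtain a h where ah: "x = a \<otimes> g \<otimes> h" "a \<in> A" "h \<in> H" by blast
    then have "a \<in> carrier G" using A by auto
    then have "x = g' \<otimes> (inv g' \<otimes> a \<otimes> g \<otimes> h)"
      using ah g by (simp add: m_assoc[symmetric])
    then show "x \<in> g' <# H" using R ah by (auto simp: l_coset_def)
  next
    fix x assume "x \<in> g' <# H"
    then obtain h where h: "x = g' \<otimes> h" "h \<in> H" by (auto simp: l_coset_def)
    \<comment> \<open>A single \<open>a\<close> suffices for this inclusion; it exists because the
      monoid consists of classes of non-empty subsets.\<close>
    obtain a where a: "a \<in> A" "a \<in> carrier G" using A by auto
    then have "inv (inv g' \<otimes> a \<otimes> g) \<otimes> h \<in> H" using R h by auto
    moreover have "x = a \<otimes> g \<otimes> (inv (inv g' \<otimes> a \<otimes> g) \<otimes> h)"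
      using a g h by (simp add: m_assoc inv_mult_group) (simp add: m_assoc[symmetric])
    ultimately show "x \<in> {a \<otimes> g \<otimes> h | a h. a \<in> A \<and> h \<in> H}" using a by blast
  qed
  then show "cls A \<otimes>\<^bsub>FP\<^esub> cls (g <# H) = cls (g' <# H)"
    using A g valid_coset[OF g(1)] set_mult_l_coset[of A g H] H.subset by (simp add: FP_mult)
qed

end

context finite_group_action
begin

lemma valid_inv: "valid A \<Longrightarrow> valid (m_inv G ` A)"
  by auto

end

section \<open>The L-class of an orbit-maximal subgroup\<close>

context orbit_maximal_subgroup
begin

abbreviation coset_cls :: "'g \<Rightarrow> 'g set set" where "coset_cls g \<equiv> cls (g <# H)"
abbreviation \<L> :: "'g set set set" where "\<L> \<equiv> L_class G M \<phi> H"

lemma cls_H: "cls H = coset_cls \<one>"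
  using H.subset by (simp add: lcos_mult_one)

lemma coset_cls_in_FP: "g \<in> carrier G \<Longrightarrow> coset_cls g \<in> carrier FP"
  by (intro fp_class_in_FP valid_coset)

lemma translate_coset_cls:
  assumes "k \<in> carrier G" "g \<in> carrier G"
  shows "cls {k} \<otimes>\<^bsub>FP\<^esub> coset_cls g = coset_cls (k \<otimes> g)"
proof -
  have "inv (k \<otimes> g) \<otimes> k \<otimes> g = \<one>" using assms by (simp add: m_assoc)
  then show ?thesis using assms by (subst coset_mult_eq_iff) simp_all
qed

text \<open>If x is the class of C H and the class of B C H is that of H, then B C lies in H, and
  any b in B gives C inside b\<inverse> H; so x is the class of b\<inverse> H. Conversely, the
  singletons of g and g\<inverse> carry H to g H and back.\<close>

lemma L_class_eq: "\<L> = coset_cls ` carrier G"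
proof (intro equalityI subsetI)
  interpret FP: monoid FP by (rule monoid_FP)
  fix x assume "x \<in> \<L>"
  then have x: "x \<in> carrier FP"
    and ideals: "{s \<otimes>\<^bsub>FP\<^esub> cls H | s. s \<in> carrier FP} = {s \<otimes>\<^bsub>FP\<^esub> x | s. s \<in> carrier FP}"
    by (simp_all add: L_class_def green_L_def)
  have H: "cls H \<in> carrier FP" unfolding cls_H by (simp add: coset_cls_in_FP)
  have "\<one>\<^bsub>FP\<^esub> \<otimes>\<^bsub>FP\<^esub> x \<in> {s \<otimes>\<^bsub>FP\<^esub> cls H | s. s \<in> carrier FP}"
    unfolding ideals using FP.one_closed by blast
  then obtain s where s: "s \<in> carrier FP" "x = s \<otimes>\<^bsub>FP\<^esub> cls H" using FP.l_one[OF x] by auto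
  have "\<one>\<^bsub>FP\<^esub> \<otimes>\<^bsub>FP\<^esub> cls H \<in> {s \<otimes>\<^bsub>FP\<^esub> x | s. s \<in> carrier FP}"
    unfolding ideals[symmetric] using FP.one_closed by blast
  then obtain t where t: "t \<in> carrier FP" "cls H = t \<otimes>\<^bsub>FP\<^esub> x" using FP.l_one[OF H] by auto
  obtain C where C: "valid C" "s = cls C" using s(1) by (rule FP_cases)
  obtain B where B: "valid B" "t = cls B" using t(1) by (rule FP_cases)
  have "cls (B <#> C) \<otimes>\<^bsub>FP\<^esub> coset_cls \<one> = coset_cls \<one>"
    using t(2) FP.m_assoc[OF t(1) s(1) H] FP_mult[OF B(1) C(1)] unfolding s(2) B(2) C(2) cls_H by simp
  then have BC: "inv \<one> \<otimes> z \<otimes> \<one> \<in> H" if "z \<in> B <#> C" for z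
    using coset_mult_eq_iff[OF valid_set_mult[OF B(1) C(1)] one_closed one_closed] that by blast
  obtain b where b: "b \<in> B" "b \<in> carrier G" using B(1) by auto
  have "cls C \<otimes>\<^bsub>FP\<^esub> coset_cls \<one> = coset_cls (inv b)"
  proof (subst coset_mult_eq_iff[OF C(1)])
    show "\<forall>c\<in>C. inv (inv b) \<otimes> c \<otimes> \<one> \<in> H"
    proof
      fix c assume c: "c \<in> C"
      then have "c \<in> carrier G" using C(1) by auto
      moreover have "b \<otimes> c \<in> B <#> C" using b c by (auto simp: set_mult_def)
      ultimately show "inv (inv b) \<otimes> c \<otimes> \<one> \<in> H" using BC[of "b \<otimes> c"] b by simp
    qed
  qed (use b in simp_all)
  then show "x \<in> coset_cls ` carrier G"
    unfolding s(2) C(2) cls_H using b by (intro image_eqI[of _ _ "inv b"]) simp_all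
next
  interpret FP: monoid FP by (rule monoid_FP)
  have ideal_le: "{s \<otimes>\<^bsub>FP\<^esub> (t \<otimes>\<^bsub>FP\<^esub> x) | s. s \<in> carrier FP} \<subseteq> {s \<otimes>\<^bsub>FP\<^esub> x | s. s \<in> carrier FP}"
    if "t \<in> carrier FP" "x \<in> carrier FP" for t x
  proof
    fix y assume "y \<in> {s \<otimes>\<^bsub>FP\<^esub> (t \<otimes>\<^bsub>FP\<^esub> x) | s. s \<in> carrier FP}"
    then obtain s where "s \<in> carrier FP" "y = s \<otimes>\<^bsub>FP\<^esub> (t \<otimes>\<^bsub>FP\<^esub> x)" by auto
    then have "y = (s \<otimes>\<^bsub>FP\<^esub> t) \<otimes>\<^bsub>FP\<^esub> x" "s \<otimes>\<^bsub>FP\<^esub> t \<in> carrier FP"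
      using that by (simp_all add: FP.m_assoc)
    then show "y \<in> {s \<otimes>\<^bsub>FP\<^esub> x | s. s \<in> carrier FP}" by auto
  qed
  fix x assume "x \<in> coset_cls ` carrier G"
  then obtain g where g: "g \<in> carrier G" "x = coset_cls g" by auto
  have mem: "cls {g} \<in> carrier FP" "cls {inv g} \<in> carrier FP" "x \<in> carrier FP" "cls H \<in> carrier FP"
    using g by (simp_all add: cls_H fp_class_in_FP coset_cls_in_FP)
  have "x = cls {g} \<otimes>\<^bsub>FP\<^esub> cls H" "cls H = cls {inv g} \<otimes>\<^bsub>FP\<^esub> x"
    using g translate_coset_cls[of g \<one>] translate_coset_cls[of "inv g" g] by (simp_all add: cls_H)
  then have "{s \<otimes>\<^bsub>FP\<^esub> cls H | s. s \<in> carrier FP} = {s \<otimes>\<^bsub>FP\<^esub> x | s. s \<in> carrier FP}"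
    using ideal_le[OF mem(1,4)] ideal_le[OF mem(2,3)] by (intro subset_antisym) simp_all
  then show "x \<in> \<L>" using mem by (simp add: L_class_def green_L_def)
qed

lemma L_class_cases:
  assumes "x \<in> \<L>"
  obtains g where "g \<in> carrier G" "x = coset_cls g"
  using assms unfolding L_class_eq by (elim imageE) (rule that; assumption)

lemma coset_cls_in_L: "g \<in> carrier G \<Longrightarrow> coset_cls g \<in> \<L>"
  unfolding L_class_eq by (rule imageI)

lemma L_class_in_FP: "x \<in> \<L> \<Longrightarrow> x \<in> carrier FP"
  by (elim L_class_cases) (simp add: coset_cls_in_FP)

lemma finite_L_class: "finite \<L>"
  unfolding L_class_eq using finite_group by (rule finite_imageI)

text \<open>Inversion turns the membership of g'\<inverse> a g in H into that of g\<inverse>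
  a\<inverse> g'. Since A\<inverse> is formed without reference to H, the same class will serve two
  subgroups at once.\<close>

lemma L_class_adjoint:
  assumes A: "valid A" and x: "x \<in> \<L>" and y: "y \<in> \<L>"
  shows "cls A \<otimes>\<^bsub>FP\<^esub> x = y \<longleftrightarrow> cls (m_inv G ` A) \<otimes>\<^bsub>FP\<^esub> y = x"
proof -
  obtain g where g: "g \<in> carrier G" "x = coset_cls g" using x by (rule L_class_cases)
  obtain g' where g': "g' \<in> carrier G" "y = coset_cls g'" using y by (rule L_class_cases)
  have "inv g' \<otimes> a \<otimes> g \<in> H \<longleftrightarrow> inv g \<otimes> inv a \<otimes> g' \<in> H" if "a \<in> A" for a
  proof -
    have a: "a \<in> carrier G" using A that by auto
    then have eq: "inv (inv g' \<otimes> a \<otimes> g) = inv g \<otimes> inv a \<otimes> g'" "inv (inv g \<otimes> inv a \<otimes> g') = inv g' \<otimes> a \<otimes> g"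
      using g g' by (simp_all add: inv_mult_group m_assoc)
    show ?thesis
      using H.m_inv_closed[of "inv g' \<otimes> a \<otimes> g"] H.m_inv_closed[of "inv g \<otimes> inv a \<otimes> g'"] unfolding eq by blast
  qed
  then show ?thesis
    unfolding g(2) g'(2) coset_mult_eq_iff[OF A g(1) g'(1)] coset_mult_eq_iff[OF valid_inv[OF A] g'(1) g(1)]
    by simp
qed

text \<open>If A B g lies in g' H, any a in A gives B g inside a\<inverse> g' H. So a product that
  has left the L-class never returns, which makes the rule with value 0 compatible with
  multiplication.\<close>

lemma L_class_mult_left_cancel:
  assumes s: "s \<in> carrier FP" and t: "t \<in> carrier FP" and x: "x \<in> \<L>" and stx: "s \<otimes>\<^bsub>FP\<^esub> (t \<otimes>\<^bsub>FP\<^esub> x) \<in> \<L>"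
  shows "t \<otimes>\<^bsub>FP\<^esub> x \<in> \<L>"
proof -
  interpret FP: monoid FP by (rule monoid_FP)
  obtain A where A: "valid A" "s = cls A" using s by (rule FP_cases)
  obtain B where B: "valid B" "t = cls B" using t by (rule FP_cases)
  obtain g where g: "g \<in> carrier G" "x = coset_cls g" using x by (rule L_class_cases)
  obtain g' where g': "g' \<in> carrier G" "s \<otimes>\<^bsub>FP\<^esub> (t \<otimes>\<^bsub>FP\<^esub> x) = coset_cls g'" using stx by (rule L_class_cases)
  obtain a where a: "a \<in> A" "a \<in> carrier G" using A(1) by auto
  have "cls (A <#> B) \<otimes>\<^bsub>FP\<^esub> coset_cls g = coset_cls g'"
    using g'(2) FP.m_assoc[OF s t L_class_in_FP[OF x]] FP_mult[OF A(1) B(1)] unfolding A(2) B(2) g(2) by simp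
  then have AB: "inv g' \<otimes> z \<otimes> g \<in> H" if "z \<in> A <#> B" for z
    using coset_mult_eq_iff[OF valid_set_mult[OF A(1) B(1)] g(1) g'(1)] that by blast
  have "cls B \<otimes>\<^bsub>FP\<^esub> coset_cls g = coset_cls (inv a \<otimes> g')"
  proof (subst coset_mult_eq_iff[OF B(1) g(1)])
    show "\<forall>b\<in>B. inv (inv a \<otimes> g') \<otimes> b \<otimes> g \<in> H"
    proof
      fix b assume b: "b \<in> B"
      then have "b \<in> carrier G" using B(1) by auto
      moreover have "a \<otimes> b \<in> A <#> B" using a b by (auto simp: set_mult_def)
      ultimately show "inv (inv a \<otimes> g') \<otimes> b \<otimes> g \<in> H"
        using AB[of "a \<otimes> b"] a g g' by (simp add: inv_mult_group m_assoc)
    qed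
  qed (use a g' in simp_all)
  then show ?thesis
    unfolding B(2) g(2) using a g' by (simp add: coset_cls_in_L)
qed

section \<open>Right multiplication by the normalizer quotient\<close>

lemma normalizer_quotient_cases:
  assumes "k \<in> carrier (normalizer_quotient G H)"
  obtains n where "n \<in> carrier G" "k = H #> n" "\<forall>h\<in>H. n \<otimes> h \<otimes> inv n \<in> H" "\<forall>h\<in>H. inv n \<otimes> h \<otimes> n \<in> H"
proof -
  obtain n where n: "n \<in> normalizer G H" "k = H #> n"
    using assms by (auto simp: carrier_FactGroup r_coset_def)
  then have nG: "n \<in> carrier G" and norm: "n <# H #> inv n = H"
    using H.subset by (auto simp: normalizer_def stabilizer_def)
  have conj: "n <# H #> inv n = {n \<otimes> h \<otimes> inv n | h. h \<in> H}" by (auto simp: l_coset_def r_coset_def)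
  have 1: "n \<otimes> h \<otimes> inv n \<in> H" if "h \<in> H" for h
    using that norm unfolding conj by blast
  \<comment> \<open>The normalizer is a stabilizer, so conjugation by \<open>n\<close> maps
    \<open>H\<close> onto itself, and each \<open>h\<close> is a conjugate of an element of
    \<open>H\<close>.\<close>
  have 2: "inv n \<otimes> h \<otimes> n \<in> H" if "h \<in> H" for h
  proof -
    have "h \<in> {n \<otimes> h \<otimes> inv n | h. h \<in> H}" using that norm unfolding conj by simp
    then obtain h' where h': "h' \<in> H" "h = n \<otimes> h' \<otimes> inv n" by auto
    then have "inv n \<otimes> h \<otimes> n = h'" using nG H.subset
      by (simp add: m_assoc subset_iff) (simp add: m_assoc[symmetric] subset_iff)
    then show ?thesis using h'(1) by simp
  qed
  show thesis using 1 2 by (intro that[OF nG n(2)] ballI)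
qed

lemma normalizer_coset_valid:
  assumes "k \<in> carrier (normalizer_quotient G H)"
  shows "valid k"
proof -
  obtain n where n: "n \<in> carrier G" "k = H #> n" using assms by (rule normalizer_quotient_cases)
  have "\<one> \<otimes> n \<in> H #> n" unfolding r_coset_def using H.one_closed by blast
  then show ?thesis unfolding n(2) using r_coset_subset_G[OF H.subset n(1)] by blast
qed

text \<open>The quotient consists of right cosets, while the L-class is described by left cosets.
  Normality moves n across H, so (g H)(H n) = g n H holds already for subsets of the group.\<close>

lemma coset_cls_mult_normalizer:
  assumes g: "g \<in> carrier G" and n: "n \<in> carrier G"
    and norm: "\<forall>h\<in>H. n \<otimes> h \<otimes> inv n \<in> H" "\<forall>h\<in>H. inv n \<otimes> h \<otimes> n \<in> H"
  shows "coset_cls g \<otimes>\<^bsub>FP\<^esub> cls (H #> n) = coset_cls (g \<otimes> n)"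
proof -
  have valid: "valid (H #> n)"
  proof -
    have "\<one> \<otimes> n \<in> H #> n" unfolding r_coset_def using H.one_closed by blast
    then show ?thesis using r_coset_subset_G[OF H.subset n] by blast
  qed
  have "(g <# H) <#> (H #> n) = (g \<otimes> n) <# H"
  proof (intro equalityI subsetI)
    fix x assume "x \<in> (g <# H) <#> (H #> n)"
    then obtain h h' where h: "h \<in> H" "h' \<in> H" "x = (g \<otimes> h) \<otimes> (h' \<otimes> n)"
      by (auto simp: set_mult_def l_coset_def r_coset_def)
    have "x = (g \<otimes> n) \<otimes> (inv n \<otimes> (h \<otimes> h') \<otimes> n)"
    proof -
      have "n \<otimes> (inv n \<otimes> (h \<otimes> (h' \<otimes> n))) = h \<otimes> (h' \<otimes> n)"
        using n h H.mem_carrier m_assoc[of n "inv n" "h \<otimes> (h' \<otimes> n)", symmetric] by simp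
      then show ?thesis using g n h H.mem_carrier by (simp add: m_assoc)
    qed
    then show "x \<in> (g \<otimes> n) <# H" using norm(2)[rule_format, of "h \<otimes> h'"] h by (auto simp: l_coset_def)
  next
    fix x assume "x \<in> (g \<otimes> n) <# H"
    then obtain h where h: "h \<in> H" "x = (g \<otimes> n) \<otimes> h" by (auto simp: l_coset_def)
    have "x = (g \<otimes> \<one>) \<otimes> ((n \<otimes> h \<otimes> inv n) \<otimes> n)"
      using g n h H.mem_carrier by (simp add: m_assoc)
    then show "x \<in> (g <# H) <#> (H #> n)"
      using norm(1)[rule_format, OF h(1)] H.one_closed unfolding set_mult_def l_coset_def r_coset_def by blast
  qed
  then show ?thesis using FP_mult[OF valid_coset[OF g] valid] by simp
qed

lemma L_class_mult_normalizer:
  assumes x: "x \<in> \<L>" and k: "k \<in> carrier (normalizer_quotient G H)"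
  shows "x \<otimes>\<^bsub>FP\<^esub> cls k \<in> \<L>"
proof -
  obtain g where g: "g \<in> carrier G" "x = coset_cls g" using x by (rule L_class_cases)
  obtain n where n: "n \<in> carrier G" "k = H #> n" "\<forall>h\<in>H. n \<otimes> h \<otimes> inv n \<in> H" "\<forall>h\<in>H. inv n \<otimes> h \<otimes> n \<in> H"
    using k by (rule normalizer_quotient_cases)
  show ?thesis
    unfolding g(2) n(2) coset_cls_mult_normalizer[OF g(1) n(1) n(3,4)] using g n by (simp add: coset_cls_in_L)
qed

lemma L_class_mult_H:
  assumes "x \<in> \<L>"
  shows "x \<otimes>\<^bsub>FP\<^esub> cls H = x"
proof -
  obtain g where g: "g \<in> carrier G" "x = coset_cls g" using assms by (rule L_class_cases)
  have "coset_cls g \<otimes>\<^bsub>FP\<^esub> cls (H #> \<one>) = coset_cls (g \<otimes> \<one>)"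
    using g(1) H.mem_carrier by (intro coset_cls_mult_normalizer) simp_all
  then show ?thesis using g coset_mult_one[OF H.subset] by simp
qed

text \<open>If A g n lies in g' H, then A g lies in g' H n\<inverse> = g' n\<inverse> H. Together
  with \<open>L_class_mult_normalizer\<close>, right multiplication by \<open>k\<close> neither
  creates nor removes a zero of the left action.\<close>

lemma L_class_mult_right_cancel:
  assumes s: "s \<in> carrier FP" and x: "x \<in> \<L>" and k: "k \<in> carrier (normalizer_quotient G H)"
    and sxk: "s \<otimes>\<^bsub>FP\<^esub> (x \<otimes>\<^bsub>FP\<^esub> cls k) \<in> \<L>"
  shows "s \<otimes>\<^bsub>FP\<^esub> x \<in> \<L>"
proof -
  obtain A where A: "valid A" "s = cls A" using s by (rule FP_cases)
  obtain g where g: "g \<in> carrier G" "x = coset_cls g" using x by (rule L_class_cases)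
  obtain n where n: "n \<in> carrier G" "k = H #> n" "\<forall>h\<in>H. n \<otimes> h \<otimes> inv n \<in> H" "\<forall>h\<in>H. inv n \<otimes> h \<otimes> n \<in> H"
    using k by (rule normalizer_quotient_cases)
  obtain g' where g': "g' \<in> carrier G" "s \<otimes>\<^bsub>FP\<^esub> (x \<otimes>\<^bsub>FP\<^esub> cls k) = coset_cls g'" using sxk by (rule L_class_cases)
  have gn: "g \<otimes> n \<in> carrier G" using g n by simp
  have mem: "inv g' \<otimes> a \<otimes> (g \<otimes> n) \<in> H" if "a \<in> A" for a
    using g'(2) coset_mult_eq_iff[OF A(1) gn g'(1)] that
    unfolding A(2) g(2) n(2) coset_cls_mult_normalizer[OF g(1) n(1) n(3,4)] by blast
  have "cls A \<otimes>\<^bsub>FP\<^esub> coset_cls g = coset_cls (g' \<otimes> inv n)"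
  proof (subst coset_mult_eq_iff[OF A(1) g(1)])
    show "\<forall>a\<in>A. inv (g' \<otimes> inv n) \<otimes> a \<otimes> g \<in> H"
    proof
      fix a assume a: "a \<in> A"
      then have "a \<in> carrier G" using A(1) by auto
      then have "inv (g' \<otimes> inv n) \<otimes> a \<otimes> g = n \<otimes> (inv g' \<otimes> a \<otimes> (g \<otimes> n)) \<otimes> inv n"
        using g g' n by (simp add: inv_mult_group m_assoc)
      then show "inv (g' \<otimes> inv n) \<otimes> a \<otimes> g \<in> H" using n(3)[rule_format, OF mem[OF a]] by simp
    qed
  qed (use g' n in simp_all)
  then show ?thesis unfolding A(2) g(2) using g' n by (simp add: coset_cls_in_L)
qed

end

section \<open>The simple modules and their tensor products\<close>

context orbit_maximal_subgroup
begin

abbreviation left_mult :: "'g set set \<Rightarrow> 'g set set \<Rightarrow> 'g set set \<Rightarrow>\<^sub>0 complex"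
  where "left_mult s x \<equiv> if s \<otimes>\<^bsub>FP\<^esub> x \<in> \<L> then Poly_Mapping.single (s \<otimes>\<^bsub>FP\<^esub> x) 1 else 0"

lemma keys_V_module: "v \<in> carrier (V_module G M \<phi> H) \<longleftrightarrow> Poly_Mapping.keys v \<subseteq> \<L>"
  by (simp add: V_module_def)

text \<open>The left action is defined through the bimodule with the identity of the normalizer
  quotient on the right. This identity is the coset H, whose class fixes the L-class from the
  right.\<close>

lemma V_left_eq:
  assumes s: "s \<in> carrier FP" and v: "Poly_Mapping.keys v \<subseteq> \<L>"
  shows "V_left G M \<phi> H s v = linear_extension (left_mult s) v"
  unfolding V_left_def V_biact_def
proof (rule linear_extension_cong)
  interpret FP: monoid FP by (rule monoid_FP)
  fix x assume "x \<in> Poly_Mapping.keys v"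
  then have x: "x \<in> \<L>" using v by blast
  have "cls H \<in> carrier FP" unfolding cls_H by (simp add: coset_cls_in_FP)
  then have "s \<otimes>\<^bsub>FP\<^esub> x \<otimes>\<^bsub>FP\<^esub> cls H = s \<otimes>\<^bsub>FP\<^esub> x"
    using FP.m_assoc[OF s L_class_in_FP[OF x], of "cls H"] L_class_mult_H[OF x] by simp
  then show "(let y = s \<otimes>\<^bsub>FP\<^esub> x \<otimes>\<^bsub>FP\<^esub> cls \<one>\<^bsub>normalizer_quotient G H\<^esub>
    in if y \<in> \<L> then Poly_Mapping.single y 1 else 0) = left_mult s x" by (simp add: Let_def)
qed

lemma V_right_eq:
  assumes k: "k \<in> carrier (normalizer_quotient G H)" and v: "Poly_Mapping.keys v \<subseteq> \<L>"
  shows "V_right G M \<phi> H v k = linear_extension (\<lambda>x. Poly_Mapping.single (x \<otimes>\<^bsub>FP\<^esub> cls k) 1) v"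
  unfolding V_right_def V_biact_def
proof (rule linear_extension_cong)
  interpret FP: monoid FP by (rule monoid_FP)
  fix x assume "x \<in> Poly_Mapping.keys v"
  then have x: "x \<in> \<L>" using v by blast
  then show "(let y = \<one>\<^bsub>FP\<^esub> \<otimes>\<^bsub>FP\<^esub> x \<otimes>\<^bsub>FP\<^esub> cls k in if y \<in> \<L> then Poly_Mapping.single y 1 else 0) =
    Poly_Mapping.single (x \<otimes>\<^bsub>FP\<^esub> cls k) 1"
    using L_class_mult_normalizer[OF x k] FP.l_one[OF L_class_in_FP[OF x]] by (simp add: Let_def)
qed

lemma V_left_closed:
  assumes "s \<in> carrier FP" "Poly_Mapping.keys v \<subseteq> \<L>"
  shows "Poly_Mapping.keys (V_left G M \<phi> H s v) \<subseteq> \<L>"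
  unfolding V_left_eq[OF assms] using assms(2) by (rule linear_extension_closed) simp

lemma V_right_closed:
  assumes "k \<in> carrier (normalizer_quotient G H)" "Poly_Mapping.keys v \<subseteq> \<L>"
  shows "Poly_Mapping.keys (V_right G M \<phi> H v k) \<subseteq> \<L>"
  unfolding V_right_eq[OF assms] using assms(2)
  by (rule linear_extension_closed) (simp add: L_class_mult_normalizer[OF _ assms(1)])

text \<open>On a basis vector x both sides are s x k or 0, and by right cancellation they are 0 for
  the same x.\<close>

lemma V_left_right_commute:
  assumes s: "s \<in> carrier FP" and k: "k \<in> carrier (normalizer_quotient G H)"
    and v: "Poly_Mapping.keys v \<subseteq> \<L>"
  shows "V_left G M \<phi> H s (V_right G M \<phi> H v k) = V_right G M \<phi> H (V_left G M \<phi> H s v) k"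
  unfolding V_left_eq[OF s V_right_closed[OF k v]] V_right_eq[OF k V_left_closed[OF s v]]
  unfolding V_left_eq[OF s v] V_right_eq[OF k v] linear_extension_comp
proof (rule linear_extension_cong)
  interpret FP: monoid FP by (rule monoid_FP)
  fix x assume "x \<in> Poly_Mapping.keys v"
  then have x: "x \<in> \<L>" using v by blast
  have kF: "cls k \<in> carrier FP" using normalizer_coset_valid[OF k] by (rule fp_class_in_FP)
  have assoc: "s \<otimes>\<^bsub>FP\<^esub> (x \<otimes>\<^bsub>FP\<^esub> cls k) = s \<otimes>\<^bsub>FP\<^esub> x \<otimes>\<^bsub>FP\<^esub> cls k"
    using FP.m_assoc[OF s L_class_in_FP[OF x] kF] by simp
  have iff: "s \<otimes>\<^bsub>FP\<^esub> x \<otimes>\<^bsub>FP\<^esub> cls k \<in> \<L> \<longleftrightarrow> s \<otimes>\<^bsub>FP\<^esub> x \<in> \<L>"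
    using L_class_mult_right_cancel[OF s x k] L_class_mult_normalizer[OF _ k] unfolding assoc by auto
  show "linear_extension (left_mult s) (Poly_Mapping.single (x \<otimes>\<^bsub>FP\<^esub> cls k) 1) =
    linear_extension (\<lambda>x. Poly_Mapping.single (x \<otimes>\<^bsub>FP\<^esub> cls k) 1) (left_mult s x)"
    unfolding linear_extension_single assoc iff scale_one
    by (cases "s \<otimes>\<^bsub>FP\<^esub> x \<in> \<L>") (simp_all add: scale_one linear_extension_def[of _ 0])
qed

lemma monoid_module_V: "monoid_module FP (V_module G M \<phi> H) (V_left G M \<phi> H)"
proof -
  interpret FP: monoid FP by (rule monoid_FP)
  have mult: "V_left G M \<phi> H (s \<otimes>\<^bsub>FP\<^esub> t) v = V_left G M \<phi> H s (V_left G M \<phi> H t v)"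
    if s: "s \<in> carrier FP" and t: "t \<in> carrier FP" and v: "Poly_Mapping.keys v \<subseteq> \<L>" for s t v
    unfolding V_left_eq[OF s V_left_closed[OF t v]]
    unfolding V_left_eq[OF t v] V_left_eq[OF FP.m_closed[OF s t] v]
      linear_extension_comp
  proof (rule linear_extension_cong)
    fix x assume "x \<in> Poly_Mapping.keys v"
    then have x: "x \<in> \<L>" using v by blast
    have assoc: "s \<otimes>\<^bsub>FP\<^esub> t \<otimes>\<^bsub>FP\<^esub> x = s \<otimes>\<^bsub>FP\<^esub> (t \<otimes>\<^bsub>FP\<^esub> x)"
      using FP.m_assoc[OF s t L_class_in_FP[OF x]] .
    \<comment> \<open>If t x is outside the L-class, the right-hand side is 0, and by left
      cancellation s t x is outside as well.\<close>
    show "left_mult (s \<otimes>\<^bsub>FP\<^esub> t) x = linear_extension (left_mult s) (left_mult t x)"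
      unfolding assoc using L_class_mult_left_cancel[OF s t x]
      by (cases "t \<otimes>\<^bsub>FP\<^esub> x \<in> \<L>") (auto simp: scale_one linear_extension_def[of _ 0])
  qed
  have one: "V_left G M \<phi> H \<one>\<^bsub>FP\<^esub> v = v" if v: "Poly_Mapping.keys v \<subseteq> \<L>" for v
  proof -
    have "linear_extension (left_mult \<one>\<^bsub>FP\<^esub>) v = linear_extension (\<lambda>x. Poly_Mapping.single x 1) v"
    proof (rule linear_extension_cong)
      fix x assume "x \<in> Poly_Mapping.keys v"
      then have x: "x \<in> \<L>" using v by blast
      show "left_mult \<one>\<^bsub>FP\<^esub> x = Poly_Mapping.single x 1"
        using x FP.l_one[OF L_class_in_FP[OF x]] by simp
    qed
    then show ?thesis unfolding V_left_eq[OF FP.one_closed v] by simp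
  qed
  have smult: "V_left G M \<phi> H s (Poly_Mapping.map ((*) c) v) = Poly_Mapping.map ((*) c) (V_left G M \<phi> H s v)" for s c v
    by (simp add: V_left_def V_biact_def linear_extension_scale)
  have add: "V_left G M \<phi> H s (v + w) = V_left G M \<phi> H s v + V_left G M \<phi> H s w" for s v w
    by (simp add: V_left_def V_biact_def linear_extension_add)
  show ?thesis
    unfolding V_module_def
    by (intro monoid_module.intro monoid_module_axioms.intro monoid_FP module_free_module)
      (simp_all add: mult one smult add V_left_closed)
qed

end

section \<open>The modules L(H, X)\<close>

locale L_construction = orbit_maximal_subgroup G M \<phi> H + U: monoid_module "normalizer_quotient G H" U \<rho>
  for G :: "('g, 'e) monoid_scheme" (structure) and M :: "'m set" and \<phi> :: "'g \<Rightarrow> 'm \<Rightarrow> 'm"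
    and H :: "'g set" and U :: "(complex, 'x) module" and \<rho> :: "'g set \<Rightarrow> 'x \<Rightarrow> 'x"
begin

lemma L_relations_cases:
  assumes "r \<in> L_relations G M \<phi> H U \<rho>"
  obtains v k u where "Poly_Mapping.keys v \<subseteq> \<L>" "k \<in> carrier (normalizer_quotient G H)" "u \<in> carrier U"
    "r = Poly_Mapping.single (V_right G M \<phi> H v k, u) 1 - Poly_Mapping.single (v, \<rho> k u) 1"
  using assms unfolding L_relations_def balanced_relations_def keys_V_module
  by (elim CollectE exE conjE) (rule that; assumption)

lemma L_relationsI:
  assumes "Poly_Mapping.keys v \<subseteq> \<L>" "k \<in> carrier (normalizer_quotient G H)" "u \<in> carrier U"
  shows "Poly_Mapping.single (V_right G M \<phi> H v k, u) 1 - Poly_Mapping.single (v, \<rho> k u) 1 \<in> L_relations G M \<phi> H U \<rho>"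
  unfolding L_relations_def balanced_relations_def keys_V_module
  by (intro CollectI exI conjI, rule refl) (fact assms)+

sublocale L: tensor_product "V_module G M \<phi> H" U "L_relations G M \<phi> H U \<rho>"
proof (intro tensor_product.intro tensor_product_axioms.intro U.V.module_axioms)
  show "module complex_ring (V_module G M \<phi> H)" unfolding V_module_def by (rule module_free_module)
  show "L_relations G M \<phi> H U \<rho> \<subseteq> carrier (free_module (carrier (V_module G M \<phi> H) \<times> carrier U))"
  proof
    fix r assume "r \<in> L_relations G M \<phi> H U \<rho>"
    then obtain v k u where r: "Poly_Mapping.keys v \<subseteq> \<L>" "k \<in> carrier (normalizer_quotient G H)" "u \<in> carrier U"
      "r = Poly_Mapping.single (V_right G M \<phi> H v k, u) 1 - Poly_Mapping.single (v, \<rho> k u) 1"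
      by (rule L_relations_cases)
    then show "r \<in> carrier (free_module (carrier (V_module G M \<phi> H) \<times> carrier U))"
      unfolding free_module_simps r(4)
      by (intro keys_diff_closed keys_single_closed)
        (simp_all add: keys_V_module V_right_closed U.act_closed)
  qed
qed

text \<open>Because left and right action commute, the relation given by v, k, u goes to the one
  given by s v, k, u; hence the left action descends to the tensor product over the group.\<close>

lemma L_relations_invariant:
  assumes s: "s \<in> carrier FP" and r: "r \<in> L_relations G M \<phi> H U \<rho>"
  shows "L.pair_map (V_left G M \<phi> H s) id r \<in> L.K"
proof -
  obtain v k u where r: "Poly_Mapping.keys v \<subseteq> \<L>" "k \<in> carrier (normalizer_quotient G H)" "u \<in> carrier U"
    "r = Poly_Mapping.single (V_right G M \<phi> H v k, u) 1 - Poly_Mapping.single (v, \<rho> k u) 1"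
    using r by (rule L_relations_cases)
  have "L.pair_map (V_left G M \<phi> H s) id r =
    Poly_Mapping.single (V_right G M \<phi> H (V_left G M \<phi> H s v) k, u) 1 - Poly_Mapping.single (V_left G M \<phi> H s v, \<rho> k u) 1"
    unfolding r(4) linear_extension_minus linear_extension_single scale_one V_left_right_commute[OF s r(2,1), symmetric]
    by simp
  also have "\<dots> \<in> L_relations G M \<phi> H U \<rho>"
    using V_left_closed[OF s r(1)] r(2,3) by (rule L_relationsI)
  finally show ?thesis by (intro L.relation_in_kernel UnI2)
qed

lemma monoid_module_L: "monoid_module FP (L_module G M \<phi> H U \<rho>) (L_act G M \<phi> H U \<rho>)"
  unfolding L_module_def L_act_def
  by (intro monoid_module_tensor[where b = "\<lambda>_. id"] monoid_module_V monoid_module_trivial monoid_FP U.V.module_axioms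
      L.relations_closed L_relations_invariant)

definition generator :: "'g set set \<Rightarrow> 'x \<Rightarrow> (('g set set \<Rightarrow>\<^sub>0 complex) \<times> 'x \<Rightarrow>\<^sub>0 complex) set"
  where "generator x u = L.pure_tensor (Poly_Mapping.single x 1) u"

lemma single_in_V: "x \<in> \<L> \<Longrightarrow> Poly_Mapping.single x 1 \<in> carrier (V_module G M \<phi> H)"
  by (simp add: keys_V_module)

lemma generator_closed: "x \<in> \<L> \<Longrightarrow> u \<in> carrier U \<Longrightarrow> generator x u \<in> carrier (L_module G M \<phi> H U \<rho>)"
  unfolding generator_def L_module_def by (intro L.pure_tensor_closed single_in_V)

text \<open>The monoid moves the class \<open>x\<close> and leaves \<open>u\<close> alone, so for
  fixed \<open>u\<close> the generators follow the kind of rule assumed of \<open>\<theta>\<close>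
  above. The zero arises as the tensor of 0 and \<open>u\<close>.\<close>

lemma L_act_generator:
  assumes s: "s \<in> carrier FP" and x: "x \<in> \<L>" and u: "u \<in> carrier U"
  shows "L_act G M \<phi> H U \<rho> s (generator x u) =
    (if s \<otimes>\<^bsub>FP\<^esub> x \<in> \<L> then generator (s \<otimes>\<^bsub>FP\<^esub> x) u else \<zero>\<^bsub>L_module G M \<phi> H U \<rho>\<^esub>)"
proof -
  interpret V: monoid_module FP "V_module G M \<phi> H" "V_left G M \<phi> H" by (rule monoid_module_V)
  have "L_act G M \<phi> H U \<rho> s (generator x u) = L.pure_tensor (V_left G M \<phi> H s (Poly_Mapping.single x 1)) (id u)"
    unfolding L_act_def generator_def
    using V.linear_endo_act[OF s] linear_endo_id L_relations_invariant[OF s] single_in_V[OF x] u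
    by (rule L.tensor_map_pure)
  also have "V_left G M \<phi> H s (Poly_Mapping.single x 1) = left_mult s x"
    using x by (subst V_left_eq[OF s]) (simp_all add: scale_one)
  finally have "L_act G M \<phi> H U \<rho> s (generator x u) = L.pure_tensor (left_mult s x) u" by simp
  moreover have "L.pure_tensor 0 u = \<zero>\<^bsub>L_module G M \<phi> H U \<rho>\<^esub>"
    using L.pure_tensor_zero_left[OF u] by (simp add: V_module_def L_module_def)
  ultimately show ?thesis by (simp add: generator_def)
qed

lemma L_submodule_eq:
  assumes N: "submodule N complex_ring (L_module G M \<phi> H U \<rho>)"
    and gen: "{generator x u | x u. x \<in> \<L> \<and> u \<in> carrier U} \<subseteq> N"
  shows "N = carrier (L_module G M \<phi> H U \<rho>)"
  using N unfolding L_module_def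
proof (rule L.tensor_submodule_eq_generators)
  show "N' = carrier (V_module G M \<phi> H)"
    if "submodule N' complex_ring (V_module G M \<phi> H)" "(\<lambda>x. Poly_Mapping.single x 1) ` \<L> \<subseteq> N'" for N'
    using that unfolding V_module_def by (intro free_module_submodule_eq) auto
  show "(\<lambda>x. Poly_Mapping.single x 1) ` \<L> \<subseteq> carrier (V_module G M \<phi> H)"
    using single_in_V by auto
  show "N' = carrier U" if "submodule N' complex_ring U" "carrier U \<subseteq> N'" for N'
    using that by (simp add: submodule_iff[OF U.V.module_axioms] subset_antisym)
  show "L.pure_tensor v w \<in> N" if "v \<in> (\<lambda>x. Poly_Mapping.single x 1) ` \<L>" "w \<in> carrier U" for v w
    using that gen by (auto simp: generator_def)
qed simp

end

section \<open>Complete reducibility of the tensor product\<close>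

theorem theorem27:
  fixes G :: "('g, 'e) monoid_scheme" and M :: "'m set" and \<phi> :: "'g \<Rightarrow> 'm \<Rightarrow> 'm"
    and H H' :: "'g set"
    and U :: "(complex, 'x) module" and \<rho> :: "'g set \<Rightarrow> 'x \<Rightarrow> 'x"
    and U' :: "(complex, 'y) module" and \<rho>' :: "'g set \<Rightarrow> 'y \<Rightarrow> 'y"
  assumes "group G" and "finite (carrier G)" and "finite M" and "faithful_action G M \<phi>"
    and "orbit_maximal G M \<phi> H" and "orbit_maximal G M \<phi> H'"
    and "simple_module (normalizer_quotient G H) U \<rho>"
    and "simple_module (normalizer_quotient G H') U' \<rho>'"
  shows "completely_reducible (factorpower G M \<phi>)
    (tensor_module (L_module G M \<phi> H U \<rho>) (L_module G M \<phi> H' U' \<rho>') {})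
    (\<lambda>s. tensor_map (L_module G M \<phi> H U \<rho>) (L_module G M \<phi> H' U' \<rho>') {}
       (L_act G M \<phi> H U \<rho> s) (L_act G M \<phi> H' U' \<rho>' s))"
proof -
  have action: "finite_group_action G M \<phi>"
    using assms(1,2,4)
    by (intro finite_group_action.intro finite_group_action_axioms.intro) (simp_all add: faithful_action_def)
  interpret A: L_construction G M \<phi> H U \<rho>
    using action assms(5,7)
    by (intro L_construction.intro orbit_maximal_subgroup.intro orbit_maximal_subgroup_axioms.intro)
      (simp_all add: simple_module_def)
  interpret B: L_construction G M \<phi> H' U' \<rho>'
    using action assms(6,8)
    by (intro L_construction.intro orbit_maximal_subgroup.intro orbit_maximal_subgroup_axioms.intro)
      (simp_all add: simple_module_def)
  interpret LA: monoid_module A.FP "L_module G M \<phi> H U \<rho>" "L_act G M \<phi> H U \<rho>"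
    by (rule A.monoid_module_L)
  interpret LB: monoid_module A.FP "L_module G M \<phi> H' U' \<rho>'" "L_act G M \<phi> H' U' \<rho>'"
    by (rule B.monoid_module_L)
  interpret T: tensor_product "L_module G M \<phi> H U \<rho>" "L_module G M \<phi> H' U' \<rho>'" "{}"
    by (intro tensor_product.intro tensor_product_axioms.intro LA.V.module_axioms LB.V.module_axioms empty_subsetI)
  let ?V = "tensor_module (L_module G M \<phi> H U \<rho>) (L_module G M \<phi> H' U' \<rho>') {}"
  let ?act = "\<lambda>s. tensor_map (L_module G M \<phi> H U \<rho>) (L_module G M \<phi> H' U' \<rho>') {}
    (L_act G M \<phi> H U \<rho> s) (L_act G M \<phi> H' U' \<rho>' s)"
  interpret W: monoid_module A.FP ?V ?act
    by (rule monoid_module_tensor[OF A.monoid_module_L B.monoid_module_L]) simp_all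
  show ?thesis
  proof (rule W.completely_reducible_if_sum_of_simples)
    fix T assume T: "invariant_submodule A.FP ?V ?act T" "\<And>W. simple_submodule A.FP ?V ?act W \<Longrightarrow> W \<subseteq> T"
    have pure: "T.pure_tensor (A.generator x u) (B.generator x' u') \<in> T"
      if x: "x \<in> A.\<L>" "x' \<in> B.\<L>" and u: "u \<in> carrier U" "u' \<in> carrier U'" for x x' u u'
    proof -
      \<comment> \<open>With \<open>u\<close> and \<open>u'\<close> fixed, the index set is the
        finite set of pairs of classes, whatever the size of \<open>U\<close> and
        \<open>U'\<close>.\<close>
      let ?\<theta> = "\<lambda>(x, x'). T.pure_tensor (A.generator x u) (B.generator x' u')"
      \<comment> \<open>A pair leaves the product of the two L-classes as soon as one component
        does, just as a tensor vanishes when one factor is zero.\<close>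
      let ?\<sigma> = "\<lambda>s (x, x'). (s \<otimes>\<^bsub>A.FP\<^esub> x, s \<otimes>\<^bsub>A.FP\<^esub> x')"
      have "?\<theta> (x, x') \<in> T"
      proof (rule W.realization_basis_in_sum_of_simples[where B = "A.\<L> \<times> B.\<L>" and \<sigma> = ?\<sigma> and T = T])
        show "finite (A.\<L> \<times> B.\<L>)" by (intro finite_cartesian_product A.finite_L_class B.finite_L_class)
        show "?\<theta> b \<in> carrier ?V" if "b \<in> A.\<L> \<times> B.\<L>" for b
          using that u by (auto intro!: T.pure_tensor_closed A.generator_closed B.generator_closed)
        show "?act s (?\<theta> b) = (if ?\<sigma> s b \<in> A.\<L> \<times> B.\<L> then ?\<theta> (?\<sigma> s b) else \<zero>\<^bsub>?V\<^esub>)"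
          if s: "s \<in> carrier A.FP" and b: "b \<in> A.\<L> \<times> B.\<L>" for s b
        proof -
          obtain y y' where y: "b = (y, y')" "y \<in> A.\<L>" "y' \<in> B.\<L>" using b by (rule SigmaE)
          have "?act s (?\<theta> b) =
            T.pure_tensor (L_act G M \<phi> H U \<rho> s (A.generator y u)) (L_act G M \<phi> H' U' \<rho>' s (B.generator y' u'))"
            unfolding y(1) prod.case
            by (rule T.tensor_map_pure[OF LA.linear_endo_act[OF s] LB.linear_endo_act[OF s] _
                  A.generator_closed[OF y(2) u(1)] B.generator_closed[OF y(3) u(2)]]) simp
          then show ?thesis
            unfolding A.L_act_generator[OF s y(2) u(1)] B.L_act_generator[OF s y(3) u(2)] y(1)
            using A.generator_closed[OF _ u(1)] B.generator_closed[OF _ u(2)] LB.V.zero_closed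
            by (auto simp: T.pure_tensor_zero_left T.pure_tensor_zero_right)
        qed
        show "\<exists>t\<in>carrier A.FP. \<forall>b\<in>A.\<L> \<times> B.\<L>. \<forall>c\<in>A.\<L> \<times> B.\<L>. ?\<sigma> s b = c \<longleftrightarrow> ?\<sigma> t c = b"
          if s: "s \<in> carrier A.FP" for s
        proof -
          obtain A where A: "A.valid A" "s = A.cls A" using s by (rule A.FP_cases)
          \<comment> \<open>The witness must be one element of the monoid for both components: the
            inverses of the elements of \<open>A\<close> reverse the action on each L-class.\<close>
          show ?thesis
            using A.L_class_adjoint[OF A(1)] B.L_class_adjoint[OF A(1)] unfolding A(2)
            by (intro bexI[of _ "A.cls (m_inv G ` A)"] A.fp_class_in_FP A.valid_inv A(1)) auto
        qed
      qed (use T x in simp_all)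
      then show ?thesis by simp
    qed
    \<comment> \<open>The generators span each factor, so their tensors, now known to lie in
      \<open>T\<close>, exhaust the module.\<close>
    show "T = carrier ?V"
      using T(1)[unfolded invariant_submodule_def, THEN conjunct1]
    proof (rule T.tensor_submodule_eq_generators)
      show "N = carrier (L_module G M \<phi> H U \<rho>)"
        if "submodule N complex_ring (L_module G M \<phi> H U \<rho>)"
          "{A.generator x u | x u. x \<in> A.\<L> \<and> u \<in> carrier U} \<subseteq> N" for N
        using that by (rule A.L_submodule_eq)
      show "N = carrier (L_module G M \<phi> H' U' \<rho>')"
        if "submodule N complex_ring (L_module G M \<phi> H' U' \<rho>')"
          "{B.generator x u | x u. x \<in> B.\<L> \<and> u \<in> carrier U'} \<subseteq> N" for N
        using that by (rule B.L_submodule_eq)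
    qed (use pure A.generator_closed B.generator_closed in blast)+
  qed
qed

end
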